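(* Let $k$ be an uncountable algebraically closed field and let $A$ be a just infinite $k$-algebra which is countably generated as a $k$-algebra. Then $A$ is stably just infinite.
   Context: All rings are associative unital algebras over a field. A $k$-algebra $A$ is called just infinite if $\dim_k(A)=\infty$ and every nonzero two-sided ideal of $A$ has finite codimension in $A$. A just infinite $k$-algebra $A$ is called stably just infinite if $A\otimes_k K$ is just infinite over $K$ for every field extension $K/k$. *)

theory Defs
  imports Main "HOL-Library.Countable_Set" "HOL-Computational_Algebra.Polynomial"
begin

text \<open>An algebra over a field 'f is given by a carrier set C, scalar multiplication sc,
  addition add, multiplication mul and zero z.\<close>

definition lin_span ::
  "('f \<Rightarrow> 'x \<Rightarrow> 'x) \<Rightarrow> ('x \<Rightarrow> 'x \<Rightarrow> 'x) \<Rightarrow> 'x \<Rightarrow> 'x set \<Rightarrow> 'x set" where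
  "lin_span sc add z S =
     \<Inter>{V. S \<subseteq> V \<and> z \<in> V \<and> (\<forall>x\<in>V. \<forall>y\<in>V. add x y \<in> V) \<and> (\<forall>c. \<forall>x\<in>V. sc c x \<in> V)}"

definition fin_dim_on ::
  "('f \<Rightarrow> 'x \<Rightarrow> 'x) \<Rightarrow> ('x \<Rightarrow> 'x \<Rightarrow> 'x) \<Rightarrow> 'x \<Rightarrow> 'x set \<Rightarrow> bool" where
  "fin_dim_on sc add z C = (\<exists>S. finite S \<and> S \<subseteq> C \<and> lin_span sc add z S = C)"

definition fin_codim_on ::
  "('f \<Rightarrow> 'x \<Rightarrow> 'x) \<Rightarrow> ('x \<Rightarrow> 'x \<Rightarrow> 'x) \<Rightarrow> 'x \<Rightarrow> 'x set \<Rightarrow> 'x set \<Rightarrow> bool" where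
  "fin_codim_on sc add z C I = (\<exists>S. finite S \<and> S \<subseteq> C \<and> lin_span sc add z (S \<union> I) = C)"

text \<open>Two-sided ideal (additive subgroup closed under multiplication on both sides;
  additive inverse of x is the scalar multiple by -1).\<close>
definition two_sided_ideal_on ::
  "('f::field \<Rightarrow> 'x \<Rightarrow> 'x) \<Rightarrow> ('x \<Rightarrow> 'x \<Rightarrow> 'x) \<Rightarrow> ('x \<Rightarrow> 'x \<Rightarrow> 'x) \<Rightarrow> 'x \<Rightarrow> 'x set
     \<Rightarrow> 'x set \<Rightarrow> bool" where
  "two_sided_ideal_on sc add mul z C I \<longleftrightarrow>
     I \<subseteq> C \<and> z \<in> I \<and> (\<forall>x\<in>I. \<forall>y\<in>I. add x y \<in> I) \<and> (\<forall>x\<in>I. sc (-1) x \<in> I) \<and>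
     (\<forall>a\<in>C. \<forall>x\<in>I. mul a x \<in> I \<and> mul x a \<in> I)"

definition just_infinite_on ::
  "('f::field \<Rightarrow> 'x \<Rightarrow> 'x) \<Rightarrow> ('x \<Rightarrow> 'x \<Rightarrow> 'x) \<Rightarrow> ('x \<Rightarrow> 'x \<Rightarrow> 'x) \<Rightarrow> 'x \<Rightarrow> 'x set \<Rightarrow> bool" where
  "just_infinite_on sc add mul z C \<longleftrightarrow>
     \<not> fin_dim_on sc add z C \<and>
     (\<forall>I. two_sided_ideal_on sc add mul z C I \<and> I \<noteq> {z} \<longrightarrow> fin_codim_on sc add z C I)"

definition is_k_algebra :: "('k::field \<Rightarrow> 'a::ring_1 \<Rightarrow> 'a) \<Rightarrow> bool" where
  "is_k_algebra scale \<longleftrightarrow> Vector_Spaces.vector_space scale \<and>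
     (\<forall>c x y. scale c (x * y) = scale c x * y \<and> scale c (x * y) = x * scale c y)"

definition just_infinite :: "('k::field \<Rightarrow> 'a::ring_1 \<Rightarrow> 'a) \<Rightarrow> bool" where
  "just_infinite scale = just_infinite_on scale (+) (*) 0 (UNIV :: 'a set)"

definition subalg_gen :: "('k::field \<Rightarrow> 'a::ring_1 \<Rightarrow> 'a) \<Rightarrow> 'a set \<Rightarrow> 'a set" where
  "subalg_gen scale S = \<Inter>{B. S \<subseteq> B \<and> 1 \<in> B \<and> (\<forall>x\<in>B. \<forall>y\<in>B. x + y \<in> B \<and> x * y \<in> B)
      \<and> (\<forall>c. \<forall>x\<in>B. scale c x \<in> B)}"

definition countably_generated :: "('k::field \<Rightarrow> 'a::ring_1 \<Rightarrow> 'a) \<Rightarrow> bool" where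
  "countably_generated scale \<longleftrightarrow> (\<exists>S. countable S \<and> subalg_gen scale S = UNIV)"

definition alg_closed_field :: "'k::field itself \<Rightarrow> bool" where
  "alg_closed_field _ \<longleftrightarrow> (\<forall>p :: 'k poly. degree p > 0 \<longrightarrow> (\<exists>x. poly p x = 0))"

definition field_ext :: "('k::field \<Rightarrow> 'K::field) \<Rightarrow> bool" where
  "field_ext \<iota> \<longleftrightarrow> \<iota> 1 = 1 \<and> (\<forall>a b. \<iota> (a + b) = \<iota> a + \<iota> b \<and> \<iota> (a * b) = \<iota> a * \<iota> b)"

text \<open>A \<otimes>_k K is the quotient of the free K-vector space on the set A (finitely supported
  functions A -> K) by the K-span N of the elements d(a+b) - d(a) - d(b) and
  d(c.a) - \<iota>(c) d(a), where d(a) is the basis vector of a. Multiplication is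
  induced by d(a) d(b) = d(ab). Elements of A \<otimes>_k K are the cosets modulo N.\<close>

definition free_sp :: "('a \<Rightarrow> 'K::field) set" where
  "free_sp = {f. finite {a. f a \<noteq> 0}}"

definition bvec :: "'a \<Rightarrow> 'a \<Rightarrow> 'K::field" where
  "bvec a = (\<lambda>x. if x = a then 1 else 0)"

definition fadd :: "('a \<Rightarrow> 'K::field) \<Rightarrow> ('a \<Rightarrow> 'K) \<Rightarrow> 'a \<Rightarrow> 'K" where
  "fadd f g = (\<lambda>x. f x + g x)"

definition fsc :: "'K::field \<Rightarrow> ('a \<Rightarrow> 'K) \<Rightarrow> 'a \<Rightarrow> 'K" where
  "fsc c f = (\<lambda>x. c * f x)"

definition fmul :: "('a::ring_1 \<Rightarrow> 'K::field) \<Rightarrow> ('a \<Rightarrow> 'K) \<Rightarrow> 'a \<Rightarrow> 'K" where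
  "fmul f g = (\<lambda>z. \<Sum>p\<in>{(a, b). f a \<noteq> 0 \<and> g b \<noteq> 0 \<and> a * b = z}. f (fst p) * g (snd p))"

definition tensor_rel :: "('k::field \<Rightarrow> 'a::ring_1 \<Rightarrow> 'a) \<Rightarrow> ('k \<Rightarrow> 'K::field) \<Rightarrow> ('a \<Rightarrow> 'K) set" where
  "tensor_rel scale \<iota> = lin_span fsc fadd (\<lambda>_. 0)
     ({fadd (bvec (a + b)) (fsc (-1) (fadd (bvec a) (bvec b))) | a b. True} \<union>
      {fadd (bvec (scale c a)) (fsc (-1) (fsc (\<iota> c) (bvec a))) | c a. True})"

definition tcls :: "('k::field \<Rightarrow> 'a::ring_1 \<Rightarrow> 'a) \<Rightarrow> ('k \<Rightarrow> 'K::field) \<Rightarrow> ('a \<Rightarrow> 'K) \<Rightarrow> ('a \<Rightarrow> 'K) set" where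
  "tcls scale \<iota> f = {g \<in> free_sp. fadd g (fsc (-1) f) \<in> tensor_rel scale \<iota>}"

definition tensor_carrier :: "('k::field \<Rightarrow> 'a::ring_1 \<Rightarrow> 'a) \<Rightarrow> ('k \<Rightarrow> 'K::field) \<Rightarrow> ('a \<Rightarrow> 'K) set set" where
  "tensor_carrier scale \<iota> = tcls scale \<iota> ` free_sp"

definition trep :: "('a \<Rightarrow> 'K) set \<Rightarrow> 'a \<Rightarrow> 'K" where
  "trep X = (SOME f. f \<in> X)"

definition tadd :: "('k::field \<Rightarrow> 'a::ring_1 \<Rightarrow> 'a) \<Rightarrow> ('k \<Rightarrow> 'K::field)
    \<Rightarrow> ('a \<Rightarrow> 'K) set \<Rightarrow> ('a \<Rightarrow> 'K) set \<Rightarrow> ('a \<Rightarrow> 'K) set" where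
  "tadd scale \<iota> X Y = tcls scale \<iota> (fadd (trep X) (trep Y))"

definition tsc :: "('k::field \<Rightarrow> 'a::ring_1 \<Rightarrow> 'a) \<Rightarrow> ('k \<Rightarrow> 'K::field)
    \<Rightarrow> 'K \<Rightarrow> ('a \<Rightarrow> 'K) set \<Rightarrow> ('a \<Rightarrow> 'K) set" where
  "tsc scale \<iota> c X = tcls scale \<iota> (fsc c (trep X))"

definition tmul :: "('k::field \<Rightarrow> 'a::ring_1 \<Rightarrow> 'a) \<Rightarrow> ('k \<Rightarrow> 'K::field)
    \<Rightarrow> ('a \<Rightarrow> 'K) set \<Rightarrow> ('a \<Rightarrow> 'K) set \<Rightarrow> ('a \<Rightarrow> 'K) set" where
  "tmul scale \<iota> X Y = tcls scale \<iota> (fmul (trep X) (trep Y))"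

definition tzero :: "('k::field \<Rightarrow> 'a::ring_1 \<Rightarrow> 'a) \<Rightarrow> ('k \<Rightarrow> 'K::field) \<Rightarrow> ('a \<Rightarrow> 'K) set" where
  "tzero scale \<iota> = tcls scale \<iota> (\<lambda>_. 0)"

definition base_change_just_infinite :: "('k::field \<Rightarrow> 'a::ring_1 \<Rightarrow> 'a) \<Rightarrow> ('k \<Rightarrow> 'K::field) \<Rightarrow> bool" where
  "base_change_just_infinite scale \<iota> =
     just_infinite_on (tsc scale \<iota>) (tadd scale \<iota>) (tmul scale \<iota>) (tzero scale \<iota>) (tensor_carrier scale \<iota>)"

end

theory Submission
  imports Defs "HOL-Library.Function_Algebras"
begin

text \<open>
  Suppose an ideal \<open>I\<close> of \<open>A \<otimes> K\<close> contains \<open>u = \<Sum> a \<otimes> f a \<noteq> 0\<close> and has infinite codimension. Then there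
  are \<open>K\<close>-linear functionals \<open>h i\<close> on \<open>A \<otimes> K\<close> vanishing on \<open>I\<close> and elements \<open>e j\<close> of \<open>A\<close> with
  \<open>h i (e j) = \<delta>\<close>. After rescaling \<open>u\<close>, some \<open>k\<close>-linear \<open>\<theta>\<close> on \<open>A\<close> has \<open>\<Sum> f a * \<theta> a = 1\<close>. As \<open>A\<close> has
  countable dimension, all \<open>f a\<close> and all values of the \<open>h i\<close> on \<open>A\<close> lie in a countably generated
  \<open>k\<close>-subalgebra \<open>R\<close> of \<open>K\<close>. Since \<open>k\<close> is uncountable and algebraically closed, \<open>R\<close> has a
  \<open>k\<close>-algebra homomorphism \<open>\<phi>\<close> to \<open>k\<close>. The element \<open>\<Sum> \<phi> (f a) a\<close> of \<open>A\<close> is nonzero, as \<open>\<theta>\<close> maps it to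
  \<open>1\<close>, and the functionals \<open>\<phi> \<circ> h i\<close> vanish on the ideal it generates while
  \<open>\<phi> (h i (e j)) = \<delta>\<close>: this ideal has infinite codimension in \<open>A\<close>, a contradiction.
\<close>

section \<open>Algebras of countable dimension\<close>

lemma lin_span_eq_span:
  assumes "vector_space sc"
  shows "lin_span sc (+) 0 S = module.span sc S"
proof -
  interpret vector_space sc by fact
  show ?thesis
    unfolding lin_span_def span_def hull_def subspace_def by (rule arg_cong[of _ _ Inter]) auto
qed

text \<open>Each vector of \<open>S\<close> lies in the span of a finite subset of \<open>B\<close>.
  There are only countably many such subsets, and the span of each contains only finitely many
  members of an independent set.\<close>

lemma (in vector_space) independent_countable:
  assumes "countable B" "independent S" "S \<subseteq> span B"
  shows "countable S"
proof -
  have sub: "S \<subseteq> (\<Union>F\<in>{F. finite F \<and> F \<subseteq> B}. S \<inter> span F)"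
  proof
    fix x assume x: "x \<in> S"
    then obtain F r where "finite F" "F \<subseteq> B" "x = (\<Sum>a\<in>F. r a *s a)"
      using assms(3) unfolding span_explicit by blast
    then have "x \<in> span F"
      by (auto intro: span_sum span_scale span_base)
    then show "x \<in> (\<Union>F\<in>{F. finite F \<and> F \<subseteq> B}. S \<inter> span F)"
      using x \<open>finite F\<close> \<open>F \<subseteq> B\<close> by blast
  qed
  have fin: "countable (S \<inter> span F)" if "finite F" for F
    using independent_span_bound[OF that, of "S \<inter> span F"] independent_mono[OF assms(2)]
    by (auto intro: countable_finite)
  have "countable (\<Union>F\<in>{F. finite F \<and> F \<subseteq> B}. S \<inter> span F)"
    by (intro countable_UN countable_Collect_finite_subset assms(1)) (use fin in blast)
  with sub show ?thesis
    by (rule countable_subset)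
qed

text \<open>A product of two words is the concatenated word; linearity in the right factor and then
  in the left one does the rest.\<close>

lemma span_monomials_mult_closed:
  fixes scale :: "'k::field \<Rightarrow> 'a::ring_1 \<Rightarrow> 'a"
  assumes "is_k_algebra scale"
    and "x \<in> module.span scale (prod_list ` lists S)" "y \<in> module.span scale (prod_list ` lists S)"
  shows "x * y \<in> module.span scale (prod_list ` lists S)"
proof -
  interpret vector_space scale
    using assms(1) by (simp add: is_k_algebra_def)
  have sc: "scale c u * v = scale c (u * v)" "u * scale c v = scale c (u * v)" for c u v
    using assms(1) by (metis is_k_algebra_def)+
  let ?M = "span (prod_list ` lists S)"
  have 1: "prod_list l * v \<in> ?M" if l: "l \<in> lists S" and v: "v \<in> ?M" for l v
    using v
  proof (induction rule: span_induct_alt)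
    case (step c u v)
    obtain l' where "u = prod_list l'" "l' \<in> lists S" using step by auto
    then have "prod_list l * u \<in> ?M"
      using l by (metis append_in_lists_conv image_eqI prod_list.append span_base)
    then show ?case using step
      by (simp add: distrib_left sc span_add span_scale)
  qed (simp add: span_zero)
  show ?thesis
    using assms(2)
  proof (induction rule: span_induct_alt)
    case (step c u v)
    then show ?case using 1 assms(3)
      by (auto simp add: distrib_right sc intro!: span_add span_scale)
  qed (simp add: span_zero)
qed

text \<open>The words in \<open>S\<close> span a subalgebra containing \<open>S\<close>. Hence
  countably many generators give a countable spanning set.\<close>

lemma subalg_gen_subset_span_monomials:
  assumes "is_k_algebra scale"
  shows "subalg_gen scale S \<subseteq> module.span scale (prod_list ` lists S)"
proof -
  interpret vector_space scale
    using assms by (simp add: is_k_algebra_def)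
  have "x \<in> prod_list ` lists S" if "x \<in> S" for x
    using that by (intro image_eqI[of _ _ "[x]"]) auto
  moreover have "1 \<in> prod_list ` lists S"
    by (intro image_eqI[of _ _ "[]"]) auto
  ultimately have "S \<subseteq> span (prod_list ` lists S)" "1 \<in> span (prod_list ` lists S)"
    by (auto intro: span_base)
  then show ?thesis
    unfolding subalg_gen_def
    by (intro Inter_lower) (auto intro: span_add span_scale span_monomials_mult_closed[OF assms])
qed

section \<open>Specialisation of countably generated subalgebras of a field extension\<close>

locale field_extension =
  fixes \<iota> :: "'k::field \<Rightarrow> 'K::field"
  assumes ext: "field_ext \<iota>"
begin

lemma hom_1: "\<iota> 1 = 1" and hom_add: "\<iota> (a + b) = \<iota> a + \<iota> b"
  and hom_mult: "\<iota> (a * b) = \<iota> a * \<iota> b"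
  using ext by (auto simp: field_ext_def)

lemma hom_0: "\<iota> 0 = 0"
  by (rule add_cancel_right_right[THEN iffD1, OF hom_add[of 0 0, unfolded add_0_left]])

lemma hom_uminus: "\<iota> (- a) = - \<iota> a"
  using hom_add[of a "-a"] by (simp add: hom_0 eq_neg_iff_add_eq_0 add.commute)

lemma hom_diff: "\<iota> (a - b) = \<iota> a - \<iota> b"
  using hom_add[of a "-b"] by (simp add: hom_uminus)

lemma extension_is_k_algebra: "is_k_algebra (\<lambda>c x. \<iota> c * x)"
  unfolding is_k_algebra_def
  by (auto intro!: vector_space.intro simp: hom_add hom_mult hom_1 algebra_simps)

sublocale ext_vs: vector_space "\<lambda>c x. \<iota> c * x"
  using extension_is_k_algebra by (simp add: is_k_algebra_def)

definition eval_at :: "'K \<Rightarrow> 'k poly \<Rightarrow> 'K" where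
  "eval_at x p = poly (map_poly \<iota> p) x"

lemma eval_at_0: "eval_at x 0 = 0"
  by (simp add: eval_at_def)

lemma eval_at_pCons: "eval_at x (pCons c p) = \<iota> c + x * eval_at x p"
  by (simp add: eval_at_def map_poly_pCons hom_0)

lemma eval_at_add: "eval_at x (p + q) = eval_at x p + eval_at x q"
  by (induction p q rule: poly_induct2) (auto simp: eval_at_0 eval_at_pCons hom_add algebra_simps)

lemma eval_at_smult: "eval_at x (smult c p) = \<iota> c * eval_at x p"
  by (induction p) (auto simp: eval_at_0 eval_at_pCons hom_mult algebra_simps)

lemma eval_at_mult: "eval_at x (p * q) = eval_at x p * eval_at x q"
  by (induction p)
     (auto simp: eval_at_0 eval_at_pCons eval_at_add eval_at_smult hom_0 algebra_simps)

lemma eval_at_1: "eval_at x 1 = 1"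
  unfolding one_pCons by (simp add: eval_at_0 eval_at_pCons hom_1)

lemma eval_at_prod: "eval_at x (prod g X) = (\<Prod>i\<in>X. eval_at x (g i))"
  by (induction X rule: infinite_finite_induct) (auto simp: eval_at_1 eval_at_mult)

lemma eval_at_sum: "eval_at x (sum g X) = (\<Sum>i\<in>X. eval_at x (g i))"
  by (induction X rule: infinite_finite_induct) (auto simp: eval_at_0 eval_at_add)

end

section \<open>Intermediate subalgebras of the extension field and their maximal ideals\<close>

locale extension_subalgebra = field_extension \<iota> for \<iota> :: "'k::field \<Rightarrow> 'K::field" +
  fixes R :: "'K set"
  assumes scalars: "\<iota> c \<in> R"
    and add_closed: "x \<in> R \<Longrightarrow> y \<in> R \<Longrightarrow> x + y \<in> R"
    and mult_closed: "x \<in> R \<Longrightarrow> y \<in> R \<Longrightarrow> x * y \<in> R"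
begin

lemma zero_closed: "0 \<in> R" and one_closed: "1 \<in> R"
  using scalars[of 0] scalars[of 1] by (auto simp: hom_0 hom_1)

lemma uminus_closed: "x \<in> R \<Longrightarrow> - x \<in> R"
  using mult_closed[OF scalars[of "-1"]] by (simp add: hom_uminus hom_1)

lemma diff_closed: "x \<in> R \<Longrightarrow> y \<in> R \<Longrightarrow> x - y \<in> R"
  using add_closed[OF _ uminus_closed] by fastforce

lemma sum_closed: "(\<And>i. i \<in> X \<Longrightarrow> g i \<in> R) \<Longrightarrow> sum g X \<in> R"
  by (induction X rule: infinite_finite_induct) (auto simp: zero_closed add_closed)

lemma eval_at_closed: "x \<in> R \<Longrightarrow> eval_at x p \<in> R"
  by (induction p) (auto simp: eval_at_0 eval_at_pCons zero_closed add_closed mult_closed scalars)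

definition proper_ideal :: "'K set \<Rightarrow> bool" where
  "proper_ideal M \<longleftrightarrow> M \<subseteq> R \<and> 0 \<in> M \<and> 1 \<notin> M \<and> (\<forall>x\<in>M. \<forall>y\<in>M. x + y \<in> M) \<and> (\<forall>r\<in>R. \<forall>x\<in>M. r * x \<in> M)"

text \<open>Zorn's lemma. Maximality is stated in the form in which it is applied: every element of
  \<open>R\<close> outside \<open>M\<close> is invertible modulo \<open>M\<close>.\<close>

lemma maximal_ideal_exists:
  obtains M where "proper_ideal M"
    and "\<And>x. x \<in> R \<Longrightarrow> x \<notin> M \<Longrightarrow> \<exists>y\<in>R. 1 - x * y \<in> M"
proof -
  have "\<exists>M\<in>Collect proper_ideal. \<forall>X\<in>Collect proper_ideal. M \<subseteq> X \<longrightarrow> X = M"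
  proof (rule subset_Zorn_nonempty)
    show "Collect proper_ideal \<noteq> {}"
      by (auto simp: proper_ideal_def zero_closed intro!: exI[of _ "{0}"])
  next
    fix \<C> assume ne: "\<C> \<noteq> {}" and ch: "subset.chain (Collect proper_ideal) \<C>"
    have p: "proper_ideal X" if "X \<in> \<C>" for X
      using ch that by (auto simp: subset.chain_def)
    have "x + y \<in> \<Union>\<C>" if "X \<in> \<C>" "x \<in> X" "Y \<in> \<C>" "y \<in> Y" for x y X Y
    proof -
      have "X \<subseteq> Y \<or> Y \<subseteq> X"
        using ch that by (auto simp: subset_chain_def)
      then show ?thesis
        using p that unfolding proper_ideal_def by (meson Union_iff subsetD)
    qed
    moreover have "r * x \<in> \<Union>\<C>" if "r \<in> R" "X \<in> \<C>" "x \<in> X" for r x X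
      using p that unfolding proper_ideal_def by blast
    moreover have "\<Union>\<C> \<subseteq> R" "0 \<in> \<Union>\<C>" "1 \<notin> \<Union>\<C>"
      using p ne unfolding proper_ideal_def by blast+
    ultimately show "\<Union>\<C> \<in> Collect proper_ideal"
      unfolding proper_ideal_def by blast
  qed
  then obtain M where M: "proper_ideal M" and max: "\<And>X. proper_ideal X \<Longrightarrow> M \<subseteq> X \<Longrightarrow> X = M"
    by auto
  show thesis
  proof (rule that[OF M])
    fix x assume x: "x \<in> R" "x \<notin> M"
    \<comment> \<open>The ideal generated by \<open>M\<close> and \<open>x\<close>. It is strictly
      larger than \<open>M\<close>, so the only clause of \<open>proper_ideal\<close> that can fail
      is \<open>1 \<notin> ?N\<close>.\<close>
    let ?N = "{m + x * r | m r. m \<in> M \<and> r \<in> R}"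
    have "M \<subseteq> ?N"
      using zero_closed by force
    moreover have "x \<in> ?N"
      using M one_closed by (force simp: proper_ideal_def)
    ultimately have "\<not> proper_ideal ?N"
      using max x by blast
    moreover have "?N \<subseteq> R" "0 \<in> ?N"
      using M x(1) \<open>M \<subseteq> ?N\<close> unfolding proper_ideal_def
      by (blast intro: add_closed mult_closed)+
    moreover have "u + v \<in> ?N" if uv: "u \<in> ?N" "v \<in> ?N" for u v
    proof -
      obtain m r m' r' where "u = m + x * r" "v = m' + x * r'" "m \<in> M" "m' \<in> M" "r \<in> R" "r' \<in> R"
        using uv by blast
      then have "u + v = (m + m') + x * (r + r')" "m + m' \<in> M" "r + r' \<in> R"
        using M by (auto simp: proper_ideal_def algebra_simps add_closed)
      then show ?thesis by blast
    qed
    moreover have "s * u \<in> ?N" if su: "s \<in> R" "u \<in> ?N" for s u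
    proof -
      obtain m r where "u = m + x * r" "m \<in> M" "r \<in> R"
        using su by blast
      then have "s * u = s * m + x * (s * r)" "s * m \<in> M" "s * r \<in> R"
        using M su by (auto simp: proper_ideal_def algebra_simps mult_closed)
      then show ?thesis by blast
    qed
    ultimately have "1 \<in> ?N"
      unfolding proper_ideal_def by blast
    then obtain m r where m: "1 = m + x * r" "m \<in> M" "r \<in> R"
      by blast
    then have "1 - x * r = m"
      by (metis add_diff_cancel_right')
    then show "\<exists>y\<in>R. 1 - x * y \<in> M"
      using m by metis
  qed
qed

text \<open>Amitsur's argument: in a residue field of countable dimension over an uncountable \<open>k\<close>, the
  inverses of \<open>x - c\<close> are linearly dependent over \<open>k\<close>, which makes \<open>x\<close> algebraic over \<open>k\<close>.\<close>

lemma residue_is_scalar: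
  assumes unc: "uncountable (UNIV :: 'k set)" and ac: "alg_closed_field TYPE('k)"
    and cB: "countable B" and RB: "R \<subseteq> ext_vs.span B"
    and M: "proper_ideal M"
    and max: "\<And>x. x \<in> R \<Longrightarrow> x \<notin> M \<Longrightarrow> \<exists>y\<in>R. 1 - x * y \<in> M"
    and x: "x \<in> R"
  shows "\<exists>c. x - \<iota> c \<in> M"
proof (rule ccontr)
  assume "\<not> ?thesis"
  then have notM: "x - \<iota> c \<notin> M" for c by blast
  have MR: "\<And>m. m \<in> M \<Longrightarrow> m \<in> R" and M0: "0 \<in> M" and M1: "1 \<notin> M"
    and Madd: "\<And>u v. u \<in> M \<Longrightarrow> v \<in> M \<Longrightarrow> u + v \<in> M"
    and Mmult: "\<And>r u. r \<in> R \<Longrightarrow> u \<in> M \<Longrightarrow> r * u \<in> M"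
    using M by (auto simp: proper_ideal_def)
  have Mdiff: "u - v \<in> M" if "u \<in> M" "v \<in> M" for u v
    using Madd[OF that(1) Mmult[OF uminus_closed[OF one_closed] that(2)]] by simp
  have Msum: "sum g X \<in> M" if "\<And>i. i \<in> X \<Longrightarrow> g i \<in> M" for g and X :: "'k set"
    using that by (induction X rule: infinite_finite_induct) (auto simp: M0 Madd)
  have prime: "v \<in> M" if uv: "u \<in> R" "v \<in> R" "u * v \<in> M" "u \<notin> M" for u v
  proof -
    obtain w where w: "w \<in> R" "1 - u * w \<in> M" using max uv by blast
    have "v * (1 - u * w) + w * (u * v) \<in> M"
      using Madd Mmult w uv by blast
    then show ?thesis by (simp add: algebra_simps)
  qed
  \<comment> \<open>So \<open>x\<close> is transcendental modulo \<open>M\<close>: over an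
    algebraically closed field \<open>p\<close> splits into linear factors, each takes a value
    \<open>x - \<iota> r\<close> outside \<open>M\<close>, and \<open>M\<close> is prime.\<close>
  have eval_notM: "eval_at x p \<notin> M" if "p \<noteq> 0" for p
    using that
  proof (induction "degree p" arbitrary: p)
    case 0
    then obtain a where a: "p = [:a:]" "a \<noteq> 0"
      by (metis degree_eq_zeroE pCons_0_0)
    show ?case
    proof
      assume "eval_at x p \<in> M"
      then have "\<iota> (inverse a) * \<iota> a \<in> M"
        using Mmult scalars by (simp add: a eval_at_pCons eval_at_0)
      then show False
        using M1 a by (simp flip: hom_mult add: hom_1)
    qed
  next
    case (Suc n)
    then obtain r where "poly p r = 0"
      using ac unfolding alg_closed_field_def by (metis zero_less_Suc)
    then obtain q where q: "p = [:-r, 1:] * q"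
      by (meson dvdE poly_eq_0_iff_dvd)
    then have q0: "q \<noteq> 0" using Suc.prems by auto
    then have "degree p = Suc (degree q)"
      unfolding q by (subst degree_mult_eq) auto
    then have "eval_at x q \<notin> M"
      using Suc q0 by simp
    moreover have "eval_at x p = (x - \<iota> r) * eval_at x q"
      unfolding q eval_at_mult by (simp add: eval_at_pCons eval_at_0 hom_uminus hom_1)
    ultimately show ?case
      using prime[of "x - \<iota> r" "eval_at x q"] notM x scalars diff_closed eval_at_closed by auto
  qed
  \<comment> \<open>The resulting \<open>y c\<close> plays the part of \<open>1 / (x - c)\<close> in
    the residue field.\<close>
  have "\<forall>c. \<exists>y\<in>R. 1 - (x - \<iota> c) * y \<in> M"
    using notM max x scalars diff_closed by blast
  then obtain y where yR: "\<And>c. y c \<in> R" and y: "\<And>c. 1 - (x - \<iota> c) * y c \<in> M"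
    by metis
  have "inj y"
  proof (rule injI, rule ccontr)
    fix c d assume eq: "y c = y d" and ne: "c \<noteq> d"
    have "(1 - (x - \<iota> c) * y c) - (1 - (x - \<iota> d) * y d) \<in> M"
      using Mdiff y by blast
    then have "\<iota> (c - d) * y c \<in> M"
      by (simp add: eq hom_diff algebra_simps)
    then have "\<iota> (inverse (c - d)) * (\<iota> (c - d) * y c) \<in> M"
      using Mmult scalars by blast
    then have "y c \<in> M"
      using ne by (simp flip: hom_mult mult.assoc add: hom_1)
    then have "(1 - (x - \<iota> c) * y c) + (x - \<iota> c) * y c \<in> M"
      using Madd Mmult y x scalars diff_closed by blast
    then show False using M1 by simp
  qed
  \<comment> \<open>The set \<open>range y\<close> is uncountable because \<open>y\<close> is
    injective, but it lies in \<open>R\<close> and thus in the span of the countable set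
    \<open>B\<close>.\<close>
  have "ext_vs.dependent (range y)"
  proof (rule ccontr)
    assume "ext_vs.independent (range y)"
    then have "countable (range y)"
      using ext_vs.independent_countable[OF cB] RB yR by blast
    then show False
      using unc \<open>inj y\<close> by (metis countable_image_inj_on)
  qed
  then obtain S u v where S: "finite S" "S \<subseteq> range y" "(\<Sum>v\<in>S. \<iota> (u v) * v) = 0"
    "v \<in> S" "u v \<noteq> 0"
    unfolding ext_vs.dependent_explicit by blast
  then obtain T where T: "S = y ` T"
    by (meson subset_imageE)
  define \<alpha> where "\<alpha> c = u (y c)" for c
  have injT: "inj_on y T" using \<open>inj y\<close> by (rule inj_on_subset) simp
  have finT: "finite T" using S T injT finite_imageD by blast
  obtain c0 where c0: "c0 \<in> T" "\<alpha> c0 \<noteq> 0" using S T \<alpha>_def by auto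
  have dep: "(\<Sum>c\<in>T. \<iota> (\<alpha> c) * y c) = 0"
    using S(3) unfolding T \<alpha>_def by (simp add: sum.reindex[OF injT])
  \<comment> \<open>Clearing denominators in the relation between the \<open>1 / (x - c)\<close>
    leaves the numerator \<open>p\<close>. As in Lagrange interpolation, only the summand of
    \<open>c0\<close> survives at \<open>c0\<close>, so \<open>p\<close> is not zero.\<close>
  define q where "q c = (\<Prod>d\<in>T-{c}. [:-d, 1:])" for c
  define p where "p = (\<Sum>c\<in>T. smult (\<alpha> c) (q c))"
  have "poly p c0 = (\<Sum>c\<in>T. \<alpha> c * (\<Prod>d\<in>T-{c}. c0 - d))"
    by (simp add: p_def q_def poly_sum poly_prod)
  also have "\<dots> = (\<Sum>c\<in>T. if c = c0 then \<alpha> c0 * (\<Prod>d\<in>T-{c0}. c0 - d) else 0)"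
    by (rule sum.cong) (use c0 finT in \<open>auto intro!: prod_zero bexI[of _ c0]\<close>)
  also have "\<dots> \<noteq> 0"
    using c0 finT by (auto simp: prod_zero_iff)
  finally have "p \<noteq> 0" by auto
  define Q where "Q = (\<Prod>d\<in>T. x - \<iota> d)"
  have ev_q: "eval_at x (q c) = (\<Prod>d\<in>T-{c}. x - \<iota> d)" for c
    by (simp add: q_def eval_at_prod eval_at_pCons eval_at_0 hom_uminus hom_1)
  \<comment> \<open>Modulo \<open>M\<close> the value of \<open>p\<close> at \<open>x\<close> is
    \<open>Q\<close> times the vanishing combination of the \<open>y c\<close>, which contradicts
    \<open>eval_notM\<close>.\<close>
  have "eval_at x p - Q * (\<Sum>c\<in>T. \<iota> (\<alpha> c) * y c) =
        (\<Sum>c\<in>T. (\<iota> (\<alpha> c) * eval_at x (q c)) * (1 - (x - \<iota> c) * y c))"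
    unfolding p_def eval_at_sum sum_distrib_left sum_subtractf[symmetric]
  proof (rule sum.cong)
    fix c assume "c \<in> T"
    then have Q: "Q = (x - \<iota> c) * eval_at x (q c)"
      unfolding Q_def ev_q using finT by (simp add: prod.remove)
    show "eval_at x (smult (\<alpha> c) (q c)) - Q * (\<iota> (\<alpha> c) * y c) =
      \<iota> (\<alpha> c) * eval_at x (q c) * (1 - (x - \<iota> c) * y c)"
      unfolding Q eval_at_smult by (simp add: algebra_simps)
  qed simp
  also have "\<dots> \<in> M"
    by (intro Msum Mmult mult_closed y scalars eval_at_closed x)
  finally show False
    using eval_notM[OF \<open>p \<noteq> 0\<close>] dep by simp
qed

text \<open>Every element of \<open>R\<close> is congruent modulo \<open>M\<close> to a scalar, and
  to only one because \<open>M\<close> contains no unit. Thus \<open>k\<close> is the residue field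
  of \<open>M\<close>, and \<open>\<phi>\<close> is the residue map.\<close>

lemma specialization_exists:
  assumes unc: "uncountable (UNIV :: 'k set)" and ac: "alg_closed_field TYPE('k)"
    and cB: "countable B" and RB: "R \<subseteq> ext_vs.span B"
  obtains \<phi> where "\<And>c. \<phi> (\<iota> c) = c"
    and "\<And>x y. x \<in> R \<Longrightarrow> y \<in> R \<Longrightarrow> \<phi> (x + y) = \<phi> x + \<phi> y"
    and "\<And>x y. x \<in> R \<Longrightarrow> y \<in> R \<Longrightarrow> \<phi> (x * y) = \<phi> x * \<phi> y"
proof -
  obtain M where M: "proper_ideal M"
    and max: "\<And>x. x \<in> R \<Longrightarrow> x \<notin> M \<Longrightarrow> \<exists>y\<in>R. 1 - x * y \<in> M"
    using maximal_ideal_exists by blast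
  have M1: "1 \<notin> M" and M0: "0 \<in> M"
    and Madd: "\<And>u v. u \<in> M \<Longrightarrow> v \<in> M \<Longrightarrow> u + v \<in> M"
    and Mmult: "\<And>r u. r \<in> R \<Longrightarrow> u \<in> M \<Longrightarrow> r * u \<in> M"
    using M by (auto simp: proper_ideal_def)
  have uniq: "c = d" if "x - \<iota> c \<in> M" "x - \<iota> d \<in> M" for x c d
  proof (rule ccontr)
    assume ne: "c \<noteq> d"
    have "\<iota> (inverse (d - c)) * ((x - \<iota> c) + (- 1) * (x - \<iota> d)) \<in> M"
      by (intro Mmult Madd that scalars uminus_closed one_closed)
    then have "\<iota> (inverse (d - c)) * \<iota> (d - c) \<in> M"
      by (simp add: hom_diff)
    then show False
      using ne M1 by (simp flip: hom_mult add: hom_1)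
  qed
  define \<phi> where "\<phi> x = (THE c. x - \<iota> c \<in> M)" for x
  have \<phi>I: "\<phi> x = c" if "x - \<iota> c \<in> M" for x c
    unfolding \<phi>_def using that uniq by blast
  have \<phi>: "x - \<iota> (\<phi> x) \<in> M" if "x \<in> R" for x
    using residue_is_scalar[OF unc ac cB RB M max that] \<phi>I by auto
  show thesis
  proof (rule that)
    show "\<phi> (\<iota> c) = c" for c by (rule \<phi>I) (simp add: M0)
  next
    fix x y assume xy: "x \<in> R" "y \<in> R"
    have "(x - \<iota> (\<phi> x)) + (y - \<iota> (\<phi> y)) \<in> M"
      by (intro Madd \<phi> xy)
    then show "\<phi> (x + y) = \<phi> x + \<phi> y"
      by (intro \<phi>I) (simp add: hom_add algebra_simps)
    have "y * (x - \<iota> (\<phi> x)) + \<iota> (\<phi> x) * (y - \<iota> (\<phi> y)) \<in> M"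
      by (intro Madd Mmult \<phi> xy scalars)
    then show "\<phi> (x * y) = \<phi> x * \<phi> y"
      by (intro \<phi>I) (simp add: hom_mult algebra_simps)
  qed
qed

end

text \<open>The subalgebra \<open>R\<close> is spanned by the words in \<open>G\<close>, of which
  there are countably many; the empty word supplies the scalars.\<close>

lemma (in field_extension) countable_specialization:
  assumes unc: "uncountable (UNIV :: 'k set)" and ac: "alg_closed_field TYPE('k)"
    and G: "countable (G :: 'K set)"
  obtains R \<phi> where "extension_subalgebra \<iota> R" "G \<subseteq> R" "\<And>c. \<phi> (\<iota> c) = c"
    and "\<And>x y. x \<in> R \<Longrightarrow> y \<in> R \<Longrightarrow> \<phi> (x + y) = \<phi> x + \<phi> y"
    and "\<And>x y. x \<in> R \<Longrightarrow> y \<in> R \<Longrightarrow> \<phi> (x * y) = \<phi> x * \<phi> y"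
proof -
  let ?B = "prod_list ` lists G"
  let ?R = "ext_vs.span ?B"
  have B: "countable ?B" using G by (intro countable_image countable_lists)
  have "1 \<in> ?B" by (intro image_eqI[of _ _ "[]"]) auto
  then have "\<iota> c \<in> ?R" for c
    using ext_vs.span_scale[OF ext_vs.span_base, of 1 ?B c] by simp
  then have R: "extension_subalgebra \<iota> ?R"
    by unfold_locales
       (auto intro: ext_vs.span_add span_monomials_mult_closed[OF extension_is_k_algebra])
  have "G \<subseteq> ?R"
  proof
    fix x assume "x \<in> G"
    then have "x \<in> ?B" by (intro image_eqI[of _ _ "[x]"]) auto
    then show "x \<in> ?R" by (rule ext_vs.span_base)
  qed
  obtain \<phi> where "\<And>c. \<phi> (\<iota> c) = c"
    and "\<And>x y. x \<in> ?R \<Longrightarrow> y \<in> ?R \<Longrightarrow> \<phi> (x + y) = \<phi> x + \<phi> y"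
    and "\<And>x y. x \<in> ?R \<Longrightarrow> y \<in> ?R \<Longrightarrow> \<phi> (x * y) = \<phi> x * \<phi> y"
    by (rule extension_subalgebra.specialization_exists[OF R unc ac B order_refl]) blast
  then show thesis
    by (rule that[OF R \<open>G \<subseteq> ?R\<close>])
qed

section \<open>Free vector spaces\<close>

text \<open>The ambient space consists of all functions, so that the library theory of bases
  applies; \<open>free_sp\<close> is then a subspace of it.\<close>

interpretation fs: vector_space "fsc :: 'K::field \<Rightarrow> ('a \<Rightarrow> 'K) \<Rightarrow> 'a \<Rightarrow> 'K"
  by unfold_locales (auto simp: fsc_def algebra_simps)

lemma fadd_eq_plus: "fadd = (+)"
  by (auto simp: fadd_def fun_eq_iff)

lemma fsc_minus_1: "fsc (-1) f = - f"
  by (auto simp: fsc_def)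

lemma inj_bvec: "inj (bvec :: 'a \<Rightarrow> 'a \<Rightarrow> 'K::field)"
  by (auto simp: inj_def bvec_def fun_eq_iff split: if_splits)

lemma sum_fun_apply: "sum g X x = (\<Sum>i\<in>X. g i x)"
  by (induction X rule: infinite_finite_induct) auto

lemma independent_bvec: "fs.independent (range (bvec :: 'a \<Rightarrow> 'a \<Rightarrow> 'K::field))"
  unfolding fs.independent_explicit_module
proof (intro allI impI)
  fix t :: "('a \<Rightarrow> 'K) set" and u v
  assume t: "finite t" "t \<subseteq> range bvec" and eq: "(\<Sum>v\<in>t. fsc (u v) v) = 0" and v: "v \<in> t"
  then obtain a where a: "v = bvec a" by blast
  have val: "w a = (if w = v then 1 else 0)" if w: "w \<in> t" for w
  proof -
    obtain b where "w = bvec b" using w t by blast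
    then show ?thesis unfolding a using inj_bvec by (auto simp: bvec_def inj_def)
  qed
  have "0 = (\<Sum>w\<in>t. fsc (u w) w a)"
    using eq by (metis sum_fun_apply zero_fun_apply)
  also have "\<dots> = (\<Sum>w\<in>t. if w = v then u v else 0)"
    by (rule sum.cong) (simp_all add: fsc_def val)
  finally show "u v = 0" using t v by simp
qed

lemma finite_supp_expansion:
  assumes "finite {a. f a \<noteq> 0}"
  shows "f = (\<Sum>a | f a \<noteq> 0. fsc (f a) (bvec a))"
proof
  fix x
  have "(\<Sum>a | f a \<noteq> 0. fsc (f a) (bvec a)) x = (\<Sum>a | f a \<noteq> 0. if a = x then f x else 0)"
    unfolding sum_fun_apply by (rule sum.cong) (auto simp: fsc_def bvec_def)
  also have "\<dots> = f x"
    using assms by simp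
  finally show "f x = (\<Sum>a | f a \<noteq> 0. fsc (f a) (bvec a)) x" by simp
qed

lemma subspace_free_sp: "fs.subspace (free_sp :: ('a \<Rightarrow> 'b::field) set)"
proof (rule fs.subspaceI)
  fix f g :: "'a \<Rightarrow> 'b::field" assume "f \<in> free_sp" "g \<in> free_sp"
  then have "finite ({a. f a \<noteq> 0} \<union> {a. g a \<noteq> 0})" by (simp add: free_sp_def)
  then show "f + g \<in> free_sp" unfolding free_sp_def
    by (auto elim!: rev_finite_subset simp del: finite_Un)
next
  fix c :: 'b and f :: "'a \<Rightarrow> 'b" assume "f \<in> free_sp"
  then show "fsc c f \<in> free_sp" unfolding free_sp_def
    by (auto simp: fsc_def elim: rev_finite_subset)
qed (simp add: free_sp_def)

lemmas free_sp_closed = fs.subspace_0[OF subspace_free_sp] fs.subspace_add[OF subspace_free_sp]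
  fs.subspace_scale[OF subspace_free_sp] fs.subspace_diff[OF subspace_free_sp]

lemma bvec_free_sp: "bvec a \<in> free_sp"
  by (auto simp: free_sp_def bvec_def)

text \<open>An induction principle: a linear condition on finitely supported functions need only be
  checked on the basis vectors.\<close>

lemma free_sp_subset:
  fixes V :: "('a \<Rightarrow> 'b::field) set"
  assumes "fs.subspace V" "\<And>a. bvec a \<in> V"
  shows "free_sp \<subseteq> V"
proof
  fix f :: "'a \<Rightarrow> 'b::field" assume "f \<in> free_sp"
  then have "f = (\<Sum>a | f a \<noteq> 0. fsc (f a) (bvec a))"
    by (intro finite_supp_expansion) (simp add: free_sp_def)
  moreover have "(\<Sum>a | f a \<noteq> 0. fsc (f a) (bvec a)) \<in> V"
    using assms by (intro fs.subspace_sum fs.subspace_scale) auto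
  ultimately show "f \<in> V" by simp
qed

section \<open>Bilinearity of the convolution product\<close>

text \<open>Replaces the sum over a fibre of the multiplication by one over a rectangle that may
  exceed the supports. Products with different factors can then be compared over a common index
  set.\<close>

lemma fmul_eq:
  assumes "finite X" "{a. f a \<noteq> 0} \<subseteq> X" "finite Y" "{a. g a \<noteq> 0} \<subseteq> Y"
  shows "fmul f g z = (\<Sum>a\<in>X. \<Sum>b\<in>Y. if a * b = z then f a * g b else 0)"
proof -
  have "fmul f g z = (\<Sum>p\<in>X \<times> Y. if fst p * snd p = z then f (fst p) * g (snd p) else 0)"
    unfolding fmul_def by (rule sum.mono_neutral_cong_left) (use assms in auto)
  then show ?thesis
    by (simp add: sum.cartesian_product split_def)
qed

lemma fmul_add_left:
  assumes "f \<in> free_sp" "g \<in> free_sp" "h \<in> free_sp"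
  shows "fmul (f + g) h = fmul f h + fmul g h"
proof
  fix z
  let ?X = "{a. f a \<noteq> 0} \<union> {a. g a \<noteq> 0}" and ?Y = "{a. h a \<noteq> 0}"
  have fin: "finite ?X" "finite ?Y" using assms by (auto simp: free_sp_def)
  have eq: "fmul u h z = (\<Sum>a\<in>?X. \<Sum>b\<in>?Y. if a * b = z then u a * h b else 0)"
    if "u \<in> {f, g, f + g}" for u
    by (rule fmul_eq) (use that fin in auto)
  have "fmul (f + g) h z = (\<Sum>a\<in>?X. \<Sum>b\<in>?Y.
      (if a * b = z then f a * h b else 0) + (if a * b = z then g a * h b else 0))"
    by (subst eq, simp, intro sum.cong) (auto simp: distrib_right)
  then show "fmul (f + g) h z = (fmul f h + fmul g h) z"
    by (simp add: sum.distrib eq)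
qed

lemma fmul_add_right:
  assumes "f \<in> free_sp" "g \<in> free_sp" "h \<in> free_sp"
  shows "fmul h (f + g) = fmul h f + fmul h g"
proof
  fix z
  let ?X = "{a. f a \<noteq> 0} \<union> {a. g a \<noteq> 0}" and ?Y = "{a. h a \<noteq> 0}"
  have fin: "finite ?X" "finite ?Y" using assms by (auto simp: free_sp_def)
  have eq: "fmul h u z = (\<Sum>a\<in>?Y. \<Sum>b\<in>?X. if a * b = z then h a * u b else 0)"
    if "u \<in> {f, g, f + g}" for u
    by (rule fmul_eq) (use that fin in auto)
  have "fmul h (f + g) z = (\<Sum>a\<in>?Y. \<Sum>b\<in>?X.
      (if a * b = z then h a * f b else 0) + (if a * b = z then h a * g b else 0))"
    by (subst eq, simp, intro sum.cong) (auto simp: distrib_left)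
  then show "fmul h (f + g) z = (fmul h f + fmul h g) z"
    by (simp add: sum.distrib eq)
qed

lemma fmul_fsc_left:
  assumes "f \<in> free_sp" "g \<in> free_sp"
  shows "fmul (fsc c f) g = fsc c (fmul f g)"
proof
  fix z
  let ?X = "{a. f a \<noteq> 0}" and ?Y = "{a. g a \<noteq> 0}"
  have fin: "finite ?X" "finite ?Y" using assms by (auto simp: free_sp_def)
  have "fmul u g z = (\<Sum>a\<in>?X. \<Sum>b\<in>?Y. if a * b = z then u a * g b else 0)"
    if "u \<in> {f, fsc c f}" for u
    by (rule fmul_eq) (use that fin in \<open>auto simp: fsc_def\<close>)
  then show "fmul (fsc c f) g z = fsc c (fmul f g) z"
    by (auto simp: fsc_def sum_distrib_left algebra_simps intro!: sum.cong)
qed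

lemma fmul_fsc_right:
  assumes "f \<in> free_sp" "g \<in> free_sp"
  shows "fmul g (fsc c f) = fsc c (fmul g f)"
proof
  fix z
  let ?X = "{a. f a \<noteq> 0}" and ?Y = "{a. g a \<noteq> 0}"
  have fin: "finite ?X" "finite ?Y" using assms by (auto simp: free_sp_def)
  have "fmul g u z = (\<Sum>a\<in>?Y. \<Sum>b\<in>?X. if a * b = z then g a * u b else 0)"
    if "u \<in> {f, fsc c f}" for u
    by (rule fmul_eq) (use that fin in \<open>auto simp: fsc_def\<close>)
  then show "fmul g (fsc c f) z = fsc c (fmul g f) z"
    by (auto simp: fsc_def sum_distrib_left algebra_simps intro!: sum.cong)
qed

lemma fmul_bvec: "fmul (bvec a) (bvec b) = (bvec (a * b) :: 'a::ring_1 \<Rightarrow> 'K::field)"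
proof
  fix z :: 'a
  have "fmul (bvec a) (bvec b) z =
    (\<Sum>x\<in>{a}. \<Sum>y\<in>{b}. if x * y = z then bvec a x * bvec b y else (0::'K))"
    by (rule fmul_eq) (auto simp: bvec_def)
  then show "fmul (bvec a) (bvec b) z = (bvec (a * b) z :: 'K)"
    by (auto simp: bvec_def)
qed

lemma fmul_0_left: "fmul 0 g = 0" and fmul_0_right: "fmul g 0 = 0"
  by (auto simp: fmul_def fun_eq_iff)

text \<open>Together with \<open>free_sp_subset\<close>, this reduces claims about products to
  products of basis vectors.\<close>

lemma subspace_fmul_left:
  assumes "fs.subspace V" "g \<in> free_sp"
  shows "fs.subspace {f \<in> free_sp. fmul f g \<in> V}"
  using assms
  by (intro fs.subspaceI)
     (auto simp: free_sp_closed fmul_0_left fmul_add_left fmul_fsc_left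
       fs.subspace_0 fs.subspace_add fs.subspace_scale)

lemma subspace_fmul_right:
  assumes "fs.subspace V" "g \<in> free_sp"
  shows "fs.subspace {f \<in> free_sp. fmul g f \<in> V}"
  using assms
  by (intro fs.subspaceI)
     (auto simp: free_sp_closed fmul_0_right fmul_add_right fmul_fsc_right
       fs.subspace_0 fs.subspace_add fs.subspace_scale)

lemma fmul_free_sp:
  assumes "f \<in> free_sp" "g \<in> free_sp"
  shows "fmul f g \<in> free_sp"
proof -
  have *: "fmul (bvec a) g \<in> free_sp" for a
    using free_sp_subset[OF subspace_fmul_right[OF subspace_free_sp bvec_free_sp[of a]]] assms(2)
    by (auto simp: bvec_free_sp fmul_bvec)
  show ?thesis
    using free_sp_subset[OF subspace_fmul_left[OF subspace_free_sp assms(2)]] assms(1) *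
    by (auto simp: bvec_free_sp)
qed

lemma fmul_diff_left:
  assumes "f \<in> free_sp" "g \<in> free_sp" "h \<in> free_sp"
  shows "fmul (f - g) h = fmul f h - fmul g h"
  using fmul_add_left[of "f - g" g h] assms by (simp add: free_sp_closed)

lemma fmul_diff_right:
  assumes "f \<in> free_sp" "g \<in> free_sp" "h \<in> free_sp"
  shows "fmul h (f - g) = fmul h f - fmul h g"
  using fmul_add_right[of "f - g" g h] assms by (simp add: free_sp_closed)

section \<open>Linear functionals on the free space\<close>

text \<open>On \<open>free_sp\<close> this is the linear functional with value \<open>h a\<close> at
  the basis vector of \<open>a\<close>.\<close>

definition lin_ext :: "('a \<Rightarrow> 'K::field) \<Rightarrow> ('a \<Rightarrow> 'K) \<Rightarrow> 'K" where
  "lin_ext h f = (\<Sum>a | f a \<noteq> 0. f a * h a)"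

lemma lin_ext_eq:
  assumes "finite X" "{a. f a \<noteq> 0} \<subseteq> X"
  shows "lin_ext h f = (\<Sum>a\<in>X. f a * h a)"
  unfolding lin_ext_def by (rule sum.mono_neutral_left) (use assms in auto)

lemma lin_ext_add:
  assumes "f \<in> free_sp" "g \<in> free_sp"
  shows "lin_ext h (f + g) = lin_ext h f + lin_ext h g"
proof -
  let ?X = "{a. f a \<noteq> 0} \<union> {a. g a \<noteq> 0}"
  have fin: "finite ?X" using assms by (auto simp: free_sp_def)
  have "lin_ext h u = (\<Sum>a\<in>?X. u a * h a)" if "u \<in> {f, g, f + g}" for u
    by (rule lin_ext_eq) (use that fin in auto)
  then show ?thesis by (simp add: sum.distrib[symmetric] algebra_simps)
qed

lemma lin_ext_fsc: "f \<in> free_sp \<Longrightarrow> lin_ext h (fsc c f) = c * lin_ext h f"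
  by (subst lin_ext_eq[of "{a. f a \<noteq> 0}"])
     (auto simp: free_sp_def fsc_def lin_ext_def sum_distrib_left algebra_simps)

lemma lin_ext_bvec: "lin_ext h (bvec a) = h a"
  by (subst lin_ext_eq[of "{a}"]) (auto simp: bvec_def)

lemma lin_ext_0: "lin_ext h 0 = 0"
  by (simp add: lin_ext_def)

lemma lin_ext_diff:
  assumes "f \<in> free_sp" "g \<in> free_sp"
  shows "lin_ext h (f - g) = lin_ext h f - lin_ext h g"
  using lin_ext_add[of "f - g" g h] assms by (simp add: free_sp_closed)

text \<open>Moves a two-sided multiplication from the argument to the functional. Vanishing on an
  ideal thereby becomes a family of equations in the coefficients of \<open>f\<close>.\<close>

lemma lin_ext_fmul_bvec:
  assumes "f \<in> free_sp"
  shows "lin_ext h (fmul (fmul (bvec x) f) (bvec y)) = lin_ext (\<lambda>a. h (x * a * y)) f"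
proof -
  let ?V = "{f \<in> free_sp. lin_ext h (fmul (fmul (bvec x) f) (bvec y)) = lin_ext (\<lambda>a. h (x * a * y)) f}"
  have "fs.subspace ?V"
    by (rule fs.subspaceI)
       (auto simp: free_sp_closed fmul_free_sp bvec_free_sp fmul_0_left fmul_0_right lin_ext_0
         fmul_add_left fmul_add_right fmul_fsc_left fmul_fsc_right lin_ext_add lin_ext_fsc)
  then have "free_sp \<subseteq> ?V"
    by (rule free_sp_subset) (simp add: bvec_free_sp fmul_bvec lin_ext_bvec)
  then show ?thesis using assms by blast
qed

lemma finite_coordinates_of_finite_span:
  fixes T :: "'v::ab_group_add \<Rightarrow> 'i \<Rightarrow> 'K::field"
  assumes "vector_space sc" and U: "module.subspace sc U"
    and T_add: "\<And>x y. x \<in> U \<Longrightarrow> y \<in> U \<Longrightarrow> T (x + y) = T x + T y"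
    and T_scale: "\<And>c x. x \<in> U \<Longrightarrow> T (sc c x) = fsc c (T x)"
    and V: "V \<subseteq> U" "\<And>v. v \<in> V \<Longrightarrow> T v = 0"
    and S: "finite S" "S \<subseteq> U"
    and J: "\<And>j. j \<in> J \<Longrightarrow> \<exists>x\<in>module.span sc (S \<union> V). T x = bvec j"
  shows "finite J"
proof -
  interpret vector_space sc by fact
  let ?W = "{x \<in> U. T x \<in> fs.span (T ` S)}"
  have "T 0 = 0"
    using T_scale[OF subspace_0[OF U], of 0] by simp
  then have "subspace ?W"
    using U by (intro subspaceI)
      (auto simp: subspace_0 subspace_add subspace_scale T_add T_scale
        intro: fs.span_zero fs.span_add fs.span_scale)
  then have "span (S \<union> V) \<subseteq> ?W"
    by (rule span_minimal[rotated]) (use S V in \<open>auto intro: fs.span_base fs.span_zero\<close>)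
  then have "bvec ` J \<subseteq> fs.span (T ` S)"
    using J by force
  then have "finite (bvec ` J :: ('i \<Rightarrow> 'K) set)"
    using fs.independent_span_bound[of "T ` S" "bvec ` J"] S
      fs.independent_mono[OF independent_bvec, of "bvec ` J"] by auto
  then show ?thesis
    by (rule finite_imageD) (rule inj_on_subset[OF inj_bvec], simp)
qed

section \<open>The scalar extension as a quotient of a free vector space\<close>

locale scalar_extension = field_extension \<iota> for \<iota> :: "'k::field \<Rightarrow> 'K::field" +
  fixes scale :: "'k \<Rightarrow> 'a::ring_1 \<Rightarrow> 'a"
  assumes alg: "is_k_algebra scale"
begin

sublocale A: vector_space scale
  using alg by (simp add: is_k_algebra_def)

lemma scale_mult: "scale c x * y = scale c (x * y)" "x * scale c y = scale c (x * y)"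
  using alg unfolding is_k_algebra_def by metis+

abbreviation cls :: "('a \<Rightarrow> 'K) \<Rightarrow> ('a \<Rightarrow> 'K) set" where
  "cls \<equiv> tcls scale \<iota>"

abbreviation N :: "('a \<Rightarrow> 'K) set" where
  "N \<equiv> tensor_rel scale \<iota>"

text \<open>These are the \<open>k\<close>-linear maps from \<open>A\<close> to \<open>K\<close>;
  they correspond to the \<open>K\<close>-linear functionals on the scalar extension.\<close>

definition semilinear :: "('a \<Rightarrow> 'K) \<Rightarrow> bool" where
  "semilinear h \<longleftrightarrow> (\<forall>a b. h (a + b) = h a + h b) \<and> (\<forall>c a. h (scale c a) = \<iota> c * h a)"

lemma tensor_rel_eq_span:
  "N = fs.span ({bvec (a + b) - (bvec a + bvec b) | a b. True} \<union>
                {bvec (scale c a) - fsc (\<iota> c) (bvec a) | c a. True})"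
  unfolding tensor_rel_def fadd_eq_plus fsc_minus_1 zero_fun_def[symmetric]
    lin_span_eq_span[OF fs.vector_space_axioms] add_uminus_conv_diff ..

lemma subspace_N: "fs.subspace N"
  unfolding tensor_rel_eq_span by simp

lemma N_subset:
  assumes "fs.subspace V" "\<And>a b. bvec (a + b) - (bvec a + bvec b) \<in> V"
    "\<And>c a. bvec (scale c a) - fsc (\<iota> c) (bvec a) \<in> V"
  shows "N \<subseteq> V"
  unfolding tensor_rel_eq_span by (rule fs.span_minimal) (use assms in auto)

lemma N_gens: "bvec (a + b) - (bvec a + bvec b) \<in> N" "bvec (scale c a) - fsc (\<iota> c) (bvec a) \<in> N"
  unfolding tensor_rel_eq_span by (rule fs.span_base, blast)+

lemma N_subset_free_sp: "N \<subseteq> free_sp"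
  by (rule N_subset) (auto simp: subspace_free_sp free_sp_closed bvec_free_sp)

lemmas N_closed = fs.subspace_0[OF subspace_N] fs.subspace_add[OF subspace_N]
  fs.subspace_scale[OF subspace_N] fs.subspace_diff[OF subspace_N]

text \<open>A generator of \<open>N\<close> times a basis vector is again a generator. That
  \<open>N\<close> is absorbed by products on both sides makes multiplication of cosets well
  defined.\<close>

lemma N_fmul_left:
  assumes "f \<in> N" "g \<in> free_sp"
  shows "fmul f g \<in> N"
proof -
  have *: "free_sp \<subseteq> {g \<in> free_sp. fmul (bvec (a + b) - (bvec a + bvec b)) g \<in> N}" for a b
    by (rule free_sp_subset[OF subspace_fmul_right[OF subspace_N]])
       (use N_gens(1) in \<open>auto simp: free_sp_closed bvec_free_sp fmul_diff_left fmul_add_left fmul_bvec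
         distrib_right\<close>)
  have **: "free_sp \<subseteq> {g \<in> free_sp. fmul (bvec (scale c a) - fsc (\<iota> c) (bvec a)) g \<in> N}" for a c
    by (rule free_sp_subset[OF subspace_fmul_right[OF subspace_N]])
       (use N_gens(2) in \<open>auto simp: free_sp_closed bvec_free_sp fmul_diff_left fmul_fsc_left fmul_bvec
         scale_mult\<close>)
  have "N \<subseteq> {f \<in> free_sp. fmul f g \<in> N}"
    by (rule N_subset[OF subspace_fmul_left[OF subspace_N assms(2)]])
       (use subsetD[OF * assms(2)] subsetD[OF ** assms(2)] in \<open>auto simp: free_sp_closed bvec_free_sp\<close>)
  then show ?thesis using assms(1) by blast
qed

lemma N_fmul_right:
  assumes "f \<in> N" "g \<in> free_sp"
  shows "fmul g f \<in> N"
proof -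
  have *: "free_sp \<subseteq> {g \<in> free_sp. fmul g (bvec (a + b) - (bvec a + bvec b)) \<in> N}" for a b
    by (rule free_sp_subset[OF subspace_fmul_left[OF subspace_N]])
       (use N_gens(1) in \<open>auto simp: free_sp_closed bvec_free_sp fmul_diff_right fmul_add_right fmul_bvec
         distrib_left\<close>)
  have **: "free_sp \<subseteq> {g \<in> free_sp. fmul g (bvec (scale c a) - fsc (\<iota> c) (bvec a)) \<in> N}" for a c
    by (rule free_sp_subset[OF subspace_fmul_left[OF subspace_N]])
       (use N_gens(2) in \<open>auto simp: free_sp_closed bvec_free_sp fmul_diff_right fmul_fsc_right fmul_bvec
         scale_mult\<close>)
  have "N \<subseteq> {f \<in> free_sp. fmul g f \<in> N}"
    by (rule N_subset[OF subspace_fmul_right[OF subspace_N assms(2)]])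
       (use subsetD[OF * assms(2)] subsetD[OF ** assms(2)] in \<open>auto simp: free_sp_closed bvec_free_sp\<close>)
  then show ?thesis using assms(1) by blast
qed

section \<open>Cosets modulo \<open>N\<close> and the induced operations\<close>

lemma mem_cls_iff: "g \<in> cls f \<longleftrightarrow> g \<in> free_sp \<and> g - f \<in> N"
  by (simp add: tcls_def fadd_eq_plus fsc_minus_1)

lemma cls_eqI:
  assumes "f - g \<in> N"
  shows "cls f = cls g"
proof -
  have "h - f \<in> N \<longleftrightarrow> h - g \<in> N" for h
    using N_closed(2)[OF _ assms, of "h - f"] N_closed(4)[OF _ assms, of "h - g"] by auto
  then show ?thesis by (auto simp: mem_cls_iff)
qed

lemma cls_eqD:
  assumes "f \<in> free_sp" "cls f = cls g"
  shows "f - g \<in> N"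
proof -
  have "f \<in> cls f" using assms(1) by (simp add: mem_cls_iff N_closed)
  then show ?thesis using assms(2) by (simp add: mem_cls_iff)
qed

lemma trep_cls:
  assumes "f \<in> free_sp"
  shows "trep (cls f) \<in> free_sp" "trep (cls f) - f \<in> N"
proof -
  have "f \<in> cls f" using assms by (simp add: mem_cls_iff N_closed)
  then have "trep (cls f) \<in> cls f"
    using someI[of "\<lambda>g. g \<in> cls f" f] by (simp add: trep_def)
  then show "trep (cls f) \<in> free_sp" "trep (cls f) - f \<in> N"
    by (auto simp: mem_cls_iff)
qed

lemma tadd_cls: "f \<in> free_sp \<Longrightarrow> g \<in> free_sp \<Longrightarrow> tadd scale \<iota> (cls f) (cls g) = cls (f + g)"
  unfolding tadd_def fadd_eq_plus
  using N_closed(2)[OF trep_cls(2) trep_cls(2), of f g] by (intro cls_eqI) (simp only: add_diff_add)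

lemma tsc_cls: "f \<in> free_sp \<Longrightarrow> tsc scale \<iota> c (cls f) = cls (fsc c f)"
  unfolding tsc_def
  using N_closed(3)[OF trep_cls(2), of f c]
  by (intro cls_eqI) (simp add: fs.scale_right_diff_distrib)

lemma tmul_cls:
  assumes f: "f \<in> free_sp" and g: "g \<in> free_sp"
  shows "tmul scale \<iota> (cls f) (cls g) = cls (fmul f g)"
  unfolding tmul_def
proof (rule cls_eqI)
  let ?f = "trep (cls f)" and ?g = "trep (cls g)"
  \<comment> \<open>This sum telescopes to the difference of the two products.\<close>
  have "fmul (?f - f) ?g + fmul f (?g - g) \<in> N"
    by (intro N_closed N_fmul_left N_fmul_right trep_cls f g)
  then show "fmul ?f ?g - fmul f g \<in> N"
    using trep_cls f g by (simp add: fmul_diff_left fmul_diff_right)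
qed

lemma tzero_eq: "tzero scale \<iota> = cls 0"
  by (simp add: tzero_def zero_fun_def)

lemma tensor_carrier_eq: "tensor_carrier scale \<iota> = cls ` free_sp"
  by (simp add: tensor_carrier_def)

abbreviation tspan :: "('a \<Rightarrow> 'K) set set \<Rightarrow> ('a \<Rightarrow> 'K) set set" where
  "tspan \<equiv> lin_span (tsc scale \<iota>) (tadd scale \<iota>) (tzero scale \<iota>)"

text \<open>Lifts a spanning set from cosets to functions. The cosets of \<open>?W\<close> are
  closed under the tensor operations and so exhaust the carrier; as \<open>N\<close> lies in
  \<open>?W\<close>, membership of a coset lifts to membership of the function.\<close>

lemma free_sp_subset_span_of_tspan:
  assumes sp: "tspan (S \<union> I) = tensor_carrier scale \<iota>"
    and S: "S \<subseteq> tensor_carrier scale \<iota>"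
    and P: "I \<subseteq> cls ` P" "P \<subseteq> free_sp" "N \<subseteq> P"
  shows "free_sp \<subseteq> fs.span (trep ` S \<union> P)"
proof -
  let ?W = "fs.span (trep ` S \<union> P)"
  have "trep ` S \<subseteq> free_sp"
    using S trep_cls(1) by (auto simp: tensor_carrier_eq)
  then have W: "?W \<subseteq> free_sp"
    using P by (intro fs.span_minimal subspace_free_sp) auto
  have "X \<in> cls ` ?W" if X: "X \<in> S" for X
  proof -
    obtain f where f: "X = cls f" "f \<in> free_sp" using X S by (auto simp: tensor_carrier_eq)
    then have "X = cls (trep X)" using cls_eqI[OF trep_cls(2)] by metis
    then show ?thesis using X by (auto intro!: image_eqI[of _ cls "trep X"] fs.span_base)
  qed
  moreover have "I \<subseteq> cls ` ?W"
    using P(1) by (auto intro: fs.span_base)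
  moreover have "tzero scale \<iota> \<in> cls ` ?W"
    by (auto simp: tzero_eq fs.span_zero)
  moreover have "tadd scale \<iota> x y \<in> cls ` ?W" if xy: "x \<in> cls ` ?W" "y \<in> cls ` ?W" for x y
  proof -
    obtain f g where fg: "x = cls f" "y = cls g" "f \<in> ?W" "g \<in> ?W" using xy by blast
    then have "tadd scale \<iota> x y = cls (f + g)" using subsetD[OF W] by (simp add: tadd_cls)
    then show ?thesis using fg by (auto intro: fs.span_add)
  qed
  moreover have "tsc scale \<iota> c x \<in> cls ` ?W" if x: "x \<in> cls ` ?W" for c x
  proof -
    obtain f where f: "x = cls f" "f \<in> ?W" using x by blast
    then have "tsc scale \<iota> c x = cls (fsc c f)" using subsetD[OF W] by (simp add: tsc_cls)
    then show ?thesis using f by (auto intro: fs.span_scale)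
  qed
  ultimately have "tspan (S \<union> I) \<subseteq> cls ` ?W"
    unfolding lin_span_def by (intro Inter_lower) auto
  then have sub: "cls ` free_sp \<subseteq> cls ` ?W" using sp by (simp add: tensor_carrier_eq)
  show ?thesis
  proof
    fix f :: "'a \<Rightarrow> 'K" assume f: "f \<in> free_sp"
    then obtain g where g: "g \<in> ?W" "cls f = cls g" using sub by blast
    have "f - g \<in> ?W" using cls_eqD[OF f g(2)] P(3) by (blast intro: fs.span_base)
    from fs.span_add[OF this g(1)] show "f \<in> ?W" by simp
  qed
qed

text \<open>The converse passage: the functions whose cosets lie in a given set \<open>V\<close>
  closed under the tensor operations form a subspace, which contains \<open>F\<close> and
  \<open>P\<close>.\<close>

lemma tspan_of_free_sp_subset_span:
  assumes sub: "free_sp \<subseteq> fs.span (F \<union> P)" and F: "F \<subseteq> free_sp" and I: "I \<subseteq> tensor_carrier scale \<iota>"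
    and P: "P \<subseteq> free_sp" "cls ` P \<subseteq> I"
  shows "tspan (cls ` F \<union> I) = tensor_carrier scale \<iota>"
proof
  show "tspan (cls ` F \<union> I) \<subseteq> tensor_carrier scale \<iota>"
    unfolding lin_span_def
    by (intro Inter_lower)
       (use F I in \<open>auto simp: tensor_carrier_eq tzero_eq tadd_cls tsc_cls free_sp_closed\<close>)
  show "tensor_carrier scale \<iota> \<subseteq> tspan (cls ` F \<union> I)"
    unfolding lin_span_def
  proof (rule Inter_greatest)
    fix V assume "V \<in> {V. cls ` F \<union> I \<subseteq> V \<and> tzero scale \<iota> \<in> V \<and>
      (\<forall>x\<in>V. \<forall>y\<in>V. tadd scale \<iota> x y \<in> V) \<and> (\<forall>c. \<forall>x\<in>V. tsc scale \<iota> c x \<in> V)}"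
    then have V: "cls ` F \<subseteq> V" "I \<subseteq> V" "cls 0 \<in> V"
      "\<And>x y. x \<in> V \<Longrightarrow> y \<in> V \<Longrightarrow> tadd scale \<iota> x y \<in> V"
      "\<And>c x. x \<in> V \<Longrightarrow> tsc scale \<iota> c x \<in> V"
      by (auto simp: tzero_eq)
    let ?W = "{f \<in> free_sp. cls f \<in> V}"
    have "fs.subspace ?W"
      using V by (intro fs.subspaceI) (auto simp: free_sp_closed simp flip: tadd_cls tsc_cls)
    then have "fs.span (F \<union> P) \<subseteq> ?W"
      by (rule fs.span_minimal[rotated]) (use V F P in auto)
    then show "tensor_carrier scale \<iota> \<subseteq> V"
      using sub by (auto simp: tensor_carrier_eq)
  qed
qed

section \<open>Functionals on the scalar extension and coordinates\<close>

lemma semilinear_lin_ext_N: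
  assumes "semilinear h" "f \<in> N"
  shows "lin_ext h f = 0"
proof -
  have "N \<subseteq> {f \<in> free_sp. lin_ext h f = 0}"
    by (rule N_subset; (rule fs.subspaceI)?)
       (use assms(1) in \<open>auto simp: free_sp_closed bvec_free_sp lin_ext_0 lin_ext_add lin_ext_fsc
          lin_ext_diff lin_ext_bvec semilinear_def\<close>)
  then show ?thesis using assms(2) by auto
qed

lemma semilinear_add: "semilinear h \<Longrightarrow> h (a + b) = h a + h b"
  and semilinear_scale: "semilinear h \<Longrightarrow> h (scale c a) = \<iota> c * h a"
  by (auto simp: semilinear_def)

lemma semilinear_0: "semilinear h \<Longrightarrow> h 0 = 0"
  using semilinear_scale[of h 0 0] by (simp add: hom_0)

lemma semilinear_sum: "semilinear h \<Longrightarrow> h (sum g X) = (\<Sum>x\<in>X. h (g x))"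
  by (induction X rule: infinite_finite_induct) (simp_all add: semilinear_0 semilinear_add)

lemma basis_exists:
  obtains B where "A.independent B" "A.span B = UNIV"
proof -
  obtain B where "A.independent B" "UNIV \<subseteq> A.span B"
    by (rule A.maximal_independent_subset_extend[OF empty_subsetI A.independent_empty, of UNIV]) blast
  then show thesis by (intro that[of B]) auto
qed

lemma semilinear_representation:
  assumes "A.independent B" "A.span B = UNIV"
  shows "semilinear (\<lambda>a. \<iota> (A.representation B a b))"
  unfolding semilinear_def
  using A.representation_add[OF assms(1)] A.representation_scale[OF assms(1)] assms(2)
  by (simp add: hom_add hom_mult)

text \<open>The coordinates with respect to a \<open>k\<close>-basis \<open>B\<close> of
  \<open>A\<close> extend to the scalar extension and send the class of each \<open>b\<close> in
  \<open>B\<close> to a unit vector. A finite spanning set would therefore make \<open>B\<close>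
  finite.\<close>

lemma not_fin_dim_scalar_extension:
  assumes "\<not> fin_dim_on scale (+) 0 (UNIV :: 'a set)"
  shows "\<not> fin_dim_on (tsc scale \<iota>) (tadd scale \<iota>) (tzero scale \<iota>) (tensor_carrier scale \<iota>)"
proof
  assume "fin_dim_on (tsc scale \<iota>) (tadd scale \<iota>) (tzero scale \<iota>) (tensor_carrier scale \<iota>)"
  then obtain S where S: "finite S" "S \<subseteq> tensor_carrier scale \<iota>" "tspan S = tensor_carrier scale \<iota>"
    by (auto simp: fin_dim_on_def)
  then have sub: "free_sp \<subseteq> fs.span (trep ` S \<union> N)"
    using free_sp_subset_span_of_tspan[of S "{}" N] N_subset_free_sp by simp
  obtain B where B: "A.independent B" "A.span B = UNIV" using basis_exists by blast
  define T :: "('a \<Rightarrow> 'K) \<Rightarrow> 'a \<Rightarrow> 'K" where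
    "T f = (\<lambda>b. lin_ext (\<lambda>a. \<iota> (A.representation B a b)) f)" for f
  have "finite B"
  proof (rule finite_coordinates_of_finite_span[OF fs.vector_space_axioms subspace_free_sp,
        where T = T and V = N and S = "trep ` S"])
    show "T (x + y) = T x + T y" if "x \<in> free_sp" "y \<in> free_sp" for x y
      using that by (auto simp: T_def lin_ext_add)
    show "T (fsc c x) = fsc c (T x)" if "x \<in> free_sp" for c x
      unfolding T_def lin_ext_fsc[OF that] by (simp add: fsc_def)
    show "T v = 0" if "v \<in> N" for v
      using semilinear_lin_ext_N[OF semilinear_representation[OF B] that] by (auto simp: T_def)
    show "trep ` S \<subseteq> free_sp"
      using S(2) trep_cls(1) by (auto simp: tensor_carrier_eq)
    show "\<exists>x\<in>fs.span (trep ` S \<union> N). T x = bvec j" if "j \<in> B" for j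
    proof
      show "T (bvec j) = bvec j"
        unfolding T_def lin_ext_bvec A.representation_basis[OF B(1) that]
        by (simp add: bvec_def hom_0 hom_1 fun_eq_iff)
      show "bvec j \<in> fs.span (trep ` S \<union> N)"
        by (rule subsetD[OF sub bvec_free_sp])
    qed
  qed (use S N_subset_free_sp in auto)
  then have "fin_dim_on scale (+) 0 (UNIV :: 'a set)"
    unfolding fin_dim_on_def lin_span_eq_span[OF A.vector_space_axioms] using B by auto
  then show False using assms by blast
qed

lemma bvec_sum_cong_N:
  assumes "finite C"
  shows "bvec (\<Sum>b\<in>C. scale (r b) b) - (\<Sum>b\<in>C. fsc (\<iota> (r b)) (bvec b)) \<in> N"
  using assms
proof (induction C)
  case empty
  \<comment> \<open>The empty sum gives \<open>bvec 0\<close>, which is not the zero function; it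
    lies in \<open>N\<close> by the scalar relation with \<open>c = 0\<close>.\<close>
  have "bvec (scale 0 0) - fsc (\<iota> 0) (bvec 0) \<in> N" by (rule N_gens)
  then show ?case by (simp add: hom_0)
next
  case (insert x C)
  let ?u = "scale (r x) x" and ?v = "\<Sum>b\<in>C. scale (r b) b" and ?w = "\<Sum>b\<in>C. fsc (\<iota> (r b)) (bvec b)"
  have "(bvec (?u + ?v) - (bvec ?u + bvec ?v)) + (bvec ?u - fsc (\<iota> (r x)) (bvec x)) + (bvec ?v - ?w) \<in> N"
    by (intro N_closed N_gens insert.IH)
  also have "(bvec (?u + ?v) - (bvec ?u + bvec ?v)) + (bvec ?u - fsc (\<iota> (r x)) (bvec x)) + (bvec ?v - ?w)
      = bvec (?u + ?v) - (fsc (\<iota> (r x)) (bvec x) + ?w)"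
    by (simp only: algebra_simps)
  finally show ?case using insert.hyps by simp
qed

text \<open>If every coordinate functional vanished on \<open>f\<close>, expanding each
  \<open>a\<close> in the basis modulo \<open>N\<close> would put \<open>f\<close> into
  \<open>N\<close>. The functional has values in \<open>k\<close> itself, so a specialisation leaves
  them fixed.\<close>

lemma separating_functional:
  assumes f: "f \<in> free_sp" "f \<notin> N"
  obtains \<theta> :: "'a \<Rightarrow> 'k" where "\<And>a b. \<theta> (a + b) = \<theta> a + \<theta> b" "\<And>c a. \<theta> (scale c a) = c * \<theta> a"
    and "lin_ext (\<lambda>a. \<iota> (\<theta> a)) f \<noteq> 0"
proof -
  obtain B where B: "A.independent B" "A.span B = UNIV" using basis_exists by blast
  let ?r = "A.representation B"
  have "\<exists>b. lin_ext (\<lambda>a. \<iota> (?r a b)) f \<noteq> 0"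
  proof (rule ccontr)
    assume "\<not> ?thesis"
    then have 0: "(\<Sum>a | f a \<noteq> 0. f a * \<iota> (?r a b)) = 0" for b by (auto simp: lin_ext_def)
    let ?X = "{a. f a \<noteq> 0}"
    have finX: "finite ?X" using f by (simp add: free_sp_def)
    define C where "C = (\<Union>a\<in>?X. {b. ?r a b \<noteq> 0})"
    have finC: "finite C" unfolding C_def using finX A.finite_representation by auto
    have repr: "(\<Sum>b\<in>C. scale (?r a b) b) = a" if "a \<in> ?X" for a
    proof -
      have "(\<Sum>b\<in>C. scale (?r a b) b) = (\<Sum>b | ?r a b \<noteq> 0. scale (?r a b) b)"
        by (rule sum.mono_neutral_right) (use finC that in \<open>auto simp: C_def\<close>)
      then show ?thesis using A.sum_nonzero_representation_eq[OF B(1)] B(2) by simp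
    qed
    have "(\<Sum>a\<in>?X. fsc (f a) (bvec a - (\<Sum>b\<in>C. fsc (\<iota> (?r a b)) (bvec b)))) \<in> N"
    proof (rule fs.subspace_sum[OF subspace_N], rule N_closed(3))
      fix a assume "a \<in> ?X"
      then show "bvec a - (\<Sum>b\<in>C. fsc (\<iota> (?r a b)) (bvec b)) \<in> N"
        using bvec_sum_cong_N[OF finC, of "?r a"] repr by simp
    qed
    also have "(\<Sum>a\<in>?X. fsc (f a) (bvec a - (\<Sum>b\<in>C. fsc (\<iota> (?r a b)) (bvec b)))) =
      (\<Sum>a\<in>?X. fsc (f a) (bvec a)) - (\<Sum>b\<in>C. \<Sum>a\<in>?X. fsc (f a * \<iota> (?r a b)) (bvec b))"
      unfolding sum.swap[of _ _ C]
      by (simp add: fs.scale_right_diff_distrib sum_subtractf fs.scale_sum_right)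
    also have "(\<Sum>b\<in>C. \<Sum>a\<in>?X. fsc (f a * \<iota> (?r a b)) (bvec b)) = 0"
      by (simp add: 0 flip: fs.scale_sum_left)
    finally show False
      using f(2) by (simp flip: finite_supp_expansion[OF finX])
  qed
  then obtain b where b: "lin_ext (\<lambda>a. \<iota> (?r a b)) f \<noteq> 0" by blast
  show thesis
    by (rule that[of "\<lambda>a. ?r a b"])
       (use A.representation_add[OF B(1)] A.representation_scale[OF B(1)] B(2) b in auto)
qed

text \<open>A basis of \<open>P\<close> is enlarged to an independent set spanning
  \<open>free_sp\<close>. Infinite codimension yields infinitely many new basis vectors, and the
  coordinates along them vanish on \<open>P\<close>, in particular on \<open>N\<close>, which makes
  them semilinear.\<close>

lemma quotient_coordinates:
  assumes P: "fs.subspace P" "P \<subseteq> free_sp" "N \<subseteq> P"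
    and inf: "\<And>E. finite E \<Longrightarrow> \<not> free_sp \<subseteq> fs.span (bvec ` E \<union> P)"
  obtains e :: "nat \<Rightarrow> 'a" and h :: "nat \<Rightarrow> 'a \<Rightarrow> 'K" where
    "\<And>i. semilinear (h i)" "\<And>i j. h i (e j) = (if i = j then 1 else 0)"
    "\<And>i f. f \<in> P \<Longrightarrow> lin_ext (h i) f = 0"
proof -
  obtain BP where BP: "BP \<subseteq> P" "fs.independent BP" "P \<subseteq> fs.span BP"
    using fs.maximal_independent_subset_extend[of "{}" P] fs.independent_empty by auto
  \<comment> \<open>New vectors are taken only from \<open>range bvec\<close>, so that the dual
    vectors come from elements \<open>e j\<close> of \<open>A\<close>.\<close>
  obtain B where B: "BP \<subseteq> B" "B \<subseteq> BP \<union> range bvec" "fs.independent B" "BP \<union> range bvec \<subseteq> fs.span B"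
    using fs.maximal_independent_subset_extend[of BP "BP \<union> range bvec"] BP(2) by auto
  have spB: "free_sp \<subseteq> fs.span B"
    by (rule free_sp_subset) (use B(4) in auto)
  define E where "E = {a. bvec a \<in> B - BP}"
  have BE: "B - BP = bvec ` E" using B(2) by (auto simp: E_def)
  have "infinite E"
  proof
    assume "finite E"
    moreover have "fs.span B \<subseteq> fs.span (bvec ` E \<union> P)"
      using BE BP(1) by (intro fs.span_mono) auto
    ultimately show False using inf spB by blast
  qed
  then obtain e :: "nat \<Rightarrow> 'a" where e: "inj e" "range e \<subseteq> E"
    using infinite_countable_subset by blast
  define \<psi> where "\<psi> i f = fs.representation B f (bvec (e i))" for i f
  have \<psi>_add: "\<psi> i (f + g) = \<psi> i f + \<psi> i g" if "f \<in> free_sp" "g \<in> free_sp" for i f g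
    using fs.representation_add[OF B(3), of g f] that subsetD[OF spB] by (simp add: \<psi>_def)
  have \<psi>_sc: "\<psi> i (fsc c f) = c * \<psi> i f" if "f \<in> free_sp" for i f c
    using fs.representation_scale[OF B(3), of f c] that subsetD[OF spB] by (simp add: \<psi>_def)
  have \<psi>_diff: "\<psi> i (f - g) = \<psi> i f - \<psi> i g" if "f \<in> free_sp" "g \<in> free_sp" for i f g
    using \<psi>_add[of "f - g" g i] that by (simp add: free_sp_closed)
  have eB: "bvec (e i) \<in> B" "bvec (e i) \<notin> BP" for i using e(2) by (auto simp: E_def)
  have \<psi>_P: "\<psi> i f = 0" if "f \<in> P" for i f
  proof -
    have "fs.representation B f = fs.representation BP f"
      using fs.representation_extend[OF B(3) _ B(1)] BP(3) that by blast
    then show ?thesis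
      using fs.representation_ne_zero[of BP f "bvec (e i)"] eB by (auto simp: \<psi>_def)
  qed
  define h where "h i a = \<psi> i (bvec a)" for i a
  have "fs.subspace {f \<in> free_sp. lin_ext (h i) f = \<psi> i f}" for i
    by (rule fs.subspaceI)
       (use \<psi>_P[OF fs.subspace_0[OF P(1)]] in
         \<open>auto simp: free_sp_closed lin_ext_0 lin_ext_add lin_ext_fsc \<psi>_add \<psi>_sc\<close>)
  from free_sp_subset[OF this] have ext: "lin_ext (h i) f = \<psi> i f" if "f \<in> free_sp" for i f
    using that by (auto simp: bvec_free_sp lin_ext_bvec h_def)
  show thesis
  proof (rule that)
    show "semilinear (h i)" for i
      unfolding semilinear_def
    proof (intro conjI allI)
      fix a b c
      have "\<psi> i (bvec (a + b) - (bvec a + bvec b)) = 0"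
        using \<psi>_P N_gens P(3) by blast
      then show "h i (a + b) = h i a + h i b"
        by (simp add: h_def \<psi>_diff \<psi>_add bvec_free_sp free_sp_closed)
      have "\<psi> i (bvec (scale c a) - fsc (\<iota> c) (bvec a)) = 0"
        using \<psi>_P N_gens P(3) by blast
      then show "h i (scale c a) = \<iota> c * h i a"
        by (simp add: h_def \<psi>_diff \<psi>_sc bvec_free_sp free_sp_closed)
    qed
    show "h i (e j) = (if i = j then 1 else 0)" for i j
      unfolding h_def \<psi>_def fs.representation_basis[OF B(3) eB(1)]
      by (simp add: inj_eq[OF inj_bvec] inj_eq[OF e(1)])
    show "lin_ext (h i) f = 0" if "f \<in> P" for i f
      using ext \<psi>_P P(2) that by auto
  qed
qed

section \<open>Specialising an ideal of infinite codimension\<close>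

lemma not_just_infinite_by_specialization:
  assumes unc: "uncountable (UNIV :: 'k set)" and ac: "alg_closed_field TYPE('k)"
    and cg: "countably_generated scale"
    and f: "f \<in> free_sp"
    and \<theta>_add: "\<And>a b. \<theta> (a + b) = \<theta> a + \<theta> b" and \<theta>_scale: "\<And>c a. \<theta> (scale c a) = c * \<theta> a"
    and \<theta>_f: "lin_ext (\<lambda>a. \<iota> (\<theta> a)) f = 1"
    and h: "\<And>i :: nat. semilinear (h i)" and he: "\<And>i j. h i (e j) = (if i = j then 1 else 0)"
    and hf: "\<And>i x y. lin_ext (\<lambda>a. h i (x * a * y)) f = 0"
  shows "\<not> just_infinite scale"
proof
  assume ji: "just_infinite scale"
  obtain S where S: "countable S" "subalg_gen scale S = UNIV"
    using cg by (auto simp: countably_generated_def)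
  define M where "M = prod_list ` lists S"
  have cM: "countable M" unfolding M_def using S(1) by (intro countable_image countable_lists)
  have spM: "A.span M = UNIV"
    using subalg_gen_subset_span_monomials[OF alg, of S] S(2) by (auto simp: M_def)
  let ?X = "{a. f a \<noteq> 0}"
  have finX: "finite ?X" using f by (simp add: free_sp_def)
  \<comment> \<open>Values on the countable spanning set \<open>M\<close> suffice: \<open>R\<close>
    contains the scalars and is closed under sums and products, so all values of \<open>h i\<close>
    follow.\<close>
  define G where "G = f ` ?X \<union> (\<Union>i. h i ` M)"
  have "countable G" unfolding G_def using finX cM by (auto intro: countable_finite)
  then obtain R \<phi> where R: "extension_subalgebra \<iota> R" and GR: "G \<subseteq> R" and \<phi>_\<iota>: "\<And>c. \<phi> (\<iota> c) = c"
    and \<phi>_add: "\<And>x y. x \<in> R \<Longrightarrow> y \<in> R \<Longrightarrow> \<phi> (x + y) = \<phi> x + \<phi> y"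
    and \<phi>_mult: "\<And>x y. x \<in> R \<Longrightarrow> y \<in> R \<Longrightarrow> \<phi> (x * y) = \<phi> x * \<phi> y"
    by (rule countable_specialization[OF unc ac]) blast
  interpret R: extension_subalgebra \<iota> R by (rule R)
  have \<phi>0: "\<phi> 0 = 0" and \<phi>1: "\<phi> 1 = 1"
    using \<phi>_\<iota>[of 0] \<phi>_\<iota>[of 1] by (simp_all add: hom_0 hom_1)
  have \<phi>_sum: "\<phi> (sum g Y) = (\<Sum>i\<in>Y. \<phi> (g i))" if "\<And>i. i \<in> Y \<Longrightarrow> g i \<in> R" for g and Y :: "'a set"
    using that by (induction Y rule: infinite_finite_induct) (auto simp: \<phi>0 \<phi>_add R.sum_closed)
  have hR: "h i a \<in> R" for i a
  proof -
    have "A.subspace {a. h i a \<in> R}"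
      using semilinear_0[OF h] semilinear_add[OF h] semilinear_scale[OF h]
      by (intro A.subspaceI) (auto simp: R.zero_closed R.add_closed R.mult_closed R.scalars)
    then have "A.span M \<subseteq> {a. h i a \<in> R}"
      by (rule A.span_minimal[rotated]) (use GR in \<open>unfold G_def, blast\<close>)
    then show ?thesis using spM by auto
  qed
  have fR: "f a \<in> R" if "a \<in> ?X" for a using GR that by (auto simp: G_def)
  \<comment> \<open>The specialisation of \<open>f\<close>: its coefficients are moved from
    \<open>R\<close> to \<open>k\<close> by \<open>\<phi>\<close>.\<close>
  define u where "u = (\<Sum>a\<in>?X. scale (\<phi> (f a)) a)"
  have \<theta>0: "\<theta> 0 = 0" using \<theta>_scale[of 0 0] by simp
  have \<theta>_sum: "\<theta> (sum g Y) = (\<Sum>i\<in>Y. \<theta> (g i))" for g and Y :: "'a set"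
    by (induction Y rule: infinite_finite_induct) (auto simp: \<theta>0 \<theta>_add)
  have "\<theta> u = (\<Sum>a\<in>?X. \<phi> (f a * \<iota> (\<theta> a)))"
    unfolding u_def \<theta>_sum by (rule sum.cong) (auto simp: \<theta>_scale \<phi>_mult fR R.scalars \<phi>_\<iota>)
  also have "\<dots> = \<phi> (lin_ext (\<lambda>a. \<iota> (\<theta> a)) f)"
    unfolding lin_ext_def by (rule \<phi>_sum[symmetric]) (auto simp: R.mult_closed fR R.scalars)
  finally have "u \<noteq> 0" using \<theta>_f \<phi>1 \<theta>0 by auto
  define T :: "'a \<Rightarrow> nat \<Rightarrow> 'k" where "T a = (\<lambda>i. \<phi> (h i a))" for a
  have T_add: "T (a + b) = T a + T b" for a b
    by (simp add: T_def fun_eq_iff semilinear_add[OF h] \<phi>_add hR)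
  have T_scale: "T (scale c a) = fsc c (T a)" for c a
    by (simp add: T_def fsc_def fun_eq_iff semilinear_scale[OF h] \<phi>_mult \<phi>_\<iota> hR R.scalars)
  have T0: "T 0 = 0" using T_scale[of 0 0] by simp
  \<comment> \<open>The \<open>i\<close>-th coordinate is \<open>\<phi>\<close> applied to the left
    side of the equation \<open>hf\<close>.\<close>
  have T_u: "T (x * u * y) = 0" for x y
  proof
    fix i
    have "x * u * y = (\<Sum>a\<in>?X. scale (\<phi> (f a)) (x * a * y))"
      by (simp add: u_def sum_distrib_left sum_distrib_right scale_mult)
    then have "T (x * u * y) i = \<phi> (\<Sum>a\<in>?X. \<iota> (\<phi> (f a)) * h i (x * a * y))"
      by (simp add: T_def semilinear_sum[OF h] semilinear_scale[OF h])
    also have "\<dots> = (\<Sum>a\<in>?X. \<phi> (f a * h i (x * a * y)))"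
      by (subst \<phi>_sum) (auto simp: R.mult_closed hR R.scalars \<phi>_mult \<phi>_\<iota> fR intro!: sum.cong)
    also have "\<dots> = \<phi> (lin_ext (\<lambda>a. h i (x * a * y)) f)"
      unfolding lin_ext_def by (rule \<phi>_sum[symmetric]) (auto simp: R.mult_closed hR fR)
    finally show "T (x * u * y) i = 0 i" by (simp add: hf \<phi>0)
  qed
  \<comment> \<open>The two-sided ideal generated by \<open>u\<close>.\<close>
  define V where "V = A.span {x * u * y | x y. True}"
  have "A.subspace {v. T v = 0}"
    by (rule A.subspaceI) (auto simp: T0 T_add T_scale)
  then have TV: "T v = 0" if "v \<in> V" for v
    using A.span_minimal[of "{x * u * y | x y. True}" "{v. T v = 0}"] T_u that by (auto simp: V_def)
  have "two_sided_ideal_on scale (+) (*) 0 UNIV V"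
    unfolding two_sided_ideal_on_def
  proof (intro conjI ballI)
    fix a v assume v: "v \<in> V"
    have "A.subspace {v. a * v \<in> V}" "A.subspace {v. v * a \<in> V}"
      unfolding V_def
      by (auto intro!: A.subspaceI simp: A.span_zero A.span_add A.span_scale distrib_left distrib_right
          scale_mult)
    moreover have "a * (x * u * y) = (a * x) * u * y" "(x * u * y) * a = x * u * (y * a)" for x y
      by (simp_all add: mult.assoc)
    then have "a * (x * u * y) \<in> V" "(x * u * y) * a \<in> V" for x y
      unfolding V_def by (metis (mono_tags, lifting) A.span_base mem_Collect_eq)+
    ultimately have "A.span {x * u * y | x y. True} \<subseteq> {v. a * v \<in> V}"
      "A.span {x * u * y | x y. True} \<subseteq> {v. v * a \<in> V}"
      by - (rule A.span_minimal, blast, assumption)+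
    then have "V \<subseteq> {v. a * v \<in> V}" "V \<subseteq> {v. v * a \<in> V}"
      by (simp_all only: V_def[symmetric])
    then show "a * v \<in> V" "v * a \<in> V" using v by auto
  qed (auto simp: V_def A.span_zero A.span_add A.span_neg)
  moreover have "1 * u * 1 \<in> V" unfolding V_def by (rule A.span_base) blast
  then have "V \<noteq> {0}" using \<open>u \<noteq> 0\<close> by auto
  ultimately have "fin_codim_on scale (+) 0 UNIV V"
    using ji by (auto simp: just_infinite_def just_infinite_on_def)
  then obtain F where F: "finite F" "A.span (F \<union> V) = UNIV"
    unfolding fin_codim_on_def lin_span_eq_span[OF A.vector_space_axioms] by auto
  \<comment> \<open>The pairing of \<open>h i\<close> with \<open>e j\<close> takes only the values
    0 and 1, both preserved by \<open>\<phi>\<close>.\<close>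
  have "T (e j) = bvec j" for j
    by (simp add: T_def he bvec_def fun_eq_iff \<phi>0 \<phi>1)
  then have "finite (UNIV :: nat set)"
    using finite_coordinates_of_finite_span[OF A.vector_space_axioms A.subspace_UNIV,
        of T V F UNIV] T_add T_scale TV F by blast
  then show False by simp
qed

lemma base_change_just_infinite:
  assumes unc: "uncountable (UNIV :: 'k set)" and ac: "alg_closed_field TYPE('k)"
    and ji: "just_infinite scale" and cg: "countably_generated scale"
  shows "base_change_just_infinite scale \<iota>"
  unfolding base_change_just_infinite_def just_infinite_on_def
proof (intro conjI allI impI)
  show "\<not> fin_dim_on (tsc scale \<iota>) (tadd scale \<iota>) (tzero scale \<iota>) (tensor_carrier scale \<iota>)"
    using ji by (intro not_fin_dim_scalar_extension) (simp add: just_infinite_def just_infinite_on_def)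
next
  fix I
  assume "two_sided_ideal_on (tsc scale \<iota>) (tadd scale \<iota>) (tmul scale \<iota>) (tzero scale \<iota>)
      (tensor_carrier scale \<iota>) I \<and> I \<noteq> {tzero scale \<iota>}"
  then have I: "I \<subseteq> cls ` free_sp" "cls 0 \<in> I" "\<And>x y. x \<in> I \<Longrightarrow> y \<in> I \<Longrightarrow> tadd scale \<iota> x y \<in> I"
    "\<And>a x. a \<in> cls ` free_sp \<Longrightarrow> x \<in> I \<Longrightarrow> tmul scale \<iota> a x \<in> I"
    "\<And>a x. a \<in> cls ` free_sp \<Longrightarrow> x \<in> I \<Longrightarrow> tmul scale \<iota> x a \<in> I"
    and I0: "I \<noteq> {cls 0}"
    by (auto simp: two_sided_ideal_on_def tensor_carrier_eq tzero_eq)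
  define P where "P = {f \<in> free_sp. cls f \<in> I}"
  have P_free: "P \<subseteq> free_sp" by (auto simp: P_def)
  have P_left: "fmul g f \<in> P" and P_right: "fmul f g \<in> P" if "f \<in> P" "g \<in> free_sp" for f g
    using that I(4,5) by (auto simp: P_def fmul_free_sp simp flip: tmul_cls)
  \<comment> \<open>The definition of an ideal demands closure under negation only; closure under
    all scalars of \<open>K\<close> comes from multiplying by \<open>c\<close> times the
    unit.\<close>
  have one: "fmul (fsc c (bvec 1)) f = fsc c f" if "f \<in> free_sp" for c f
  proof -
    let ?V = "{f \<in> free_sp. fmul (bvec 1) f = f}"
    have "fs.subspace ?V"
      by (rule fs.subspaceI)
         (auto simp: free_sp_closed bvec_free_sp fmul_0_right fmul_add_right fmul_fsc_right)
    then have "free_sp \<subseteq> ?V"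
      by (rule free_sp_subset) (simp add: bvec_free_sp fmul_bvec)
    then show ?thesis using that by (auto simp: fmul_fsc_left bvec_free_sp)
  qed
  have P_sub: "fs.subspace P"
  proof (rule fs.subspaceI)
    show "0 \<in> P" using I(2) by (simp add: P_def free_sp_closed)
    show "f + g \<in> P" if "f \<in> P" "g \<in> P" for f g
      using that I(3) by (auto simp: P_def free_sp_closed simp flip: tadd_cls)
    show "fsc c f \<in> P" if "f \<in> P" for c f
      using P_left[OF that, of "fsc c (bvec 1)"] that P_free one[of f c]
      by (auto simp: free_sp_closed bvec_free_sp)
  qed
  have N_P: "N \<subseteq> P"
  proof
    fix n assume n: "n \<in> N"
    then have "cls n = cls 0" by (intro cls_eqI) simp
    then show "n \<in> P" using n N_subset_free_sp I(2) by (auto simp: P_def)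
  qed
  obtain g where g: "g \<in> P" "g \<notin> N"
  proof -
    obtain X where "X \<in> I" "X \<noteq> cls 0" using I(2) I0 by blast
    then obtain g where "g \<in> free_sp" "cls g \<in> I" "cls g \<noteq> cls 0" using I(1) by blast
    then show thesis using that cls_eqI[of g 0] by (auto simp: P_def)
  qed
  then obtain \<theta> :: "'a \<Rightarrow> 'k" where \<theta>: "\<And>a b. \<theta> (a + b) = \<theta> a + \<theta> b" "\<And>c a. \<theta> (scale c a) = c * \<theta> a"
    "lin_ext (\<lambda>a. \<iota> (\<theta> a)) g \<noteq> 0"
    using separating_functional P_free by blast
  \<comment> \<open>The rescaling is essential: \<open>\<phi>\<close> could send an arbitrary
    nonzero value to 0, but it fixes 1.\<close>
  define f where "f = fsc (inverse (lin_ext (\<lambda>a. \<iota> (\<theta> a)) g)) g"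
  have f: "f \<in> P" "f \<in> free_sp"
    using g(1) P_free by (auto simp: f_def fs.subspace_scale[OF P_sub])
  have \<theta>_f: "lin_ext (\<lambda>a. \<iota> (\<theta> a)) f = 1"
    unfolding f_def using g(1) P_free \<theta>(3) by (subst lin_ext_fsc) auto
  show "fin_codim_on (tsc scale \<iota>) (tadd scale \<iota>) (tzero scale \<iota>) (tensor_carrier scale \<iota>) I"
  proof (rule ccontr)
    assume inf: "\<not> ?thesis"
    have not_sub: "\<not> free_sp \<subseteq> fs.span (bvec ` E \<union> P)" if E: "finite E" for E
    proof
      assume "free_sp \<subseteq> fs.span (bvec ` E \<union> P)"
      then have "tspan (cls ` bvec ` E \<union> I) = tensor_carrier scale \<iota>"
        by (rule tspan_of_free_sp_subset_span) (use I(1) in \<open>auto simp: P_def bvec_free_sp tensor_carrier_eq\<close>)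
      moreover have "cls ` bvec ` E \<subseteq> tensor_carrier scale \<iota>"
        by (auto simp: tensor_carrier_eq bvec_free_sp)
      ultimately have "fin_codim_on (tsc scale \<iota>) (tadd scale \<iota>) (tzero scale \<iota>) (tensor_carrier scale \<iota>) I"
        unfolding fin_codim_on_def using E by (intro exI[of _ "cls ` bvec ` E"]) simp
      then show False using inf by contradiction
    qed
    obtain e :: "nat \<Rightarrow> 'a" and h :: "nat \<Rightarrow> 'a \<Rightarrow> 'K" where h: "\<And>i. semilinear (h i)"
      "\<And>i j. h i (e j) = (if i = j then 1 else 0)" "\<And>i f. f \<in> P \<Longrightarrow> lin_ext (h i) f = 0"
      by (rule quotient_coordinates[OF P_sub P_free N_P not_sub]) blast+
    \<comment> \<open>The product of \<open>f\<close> with basis vectors on both sides stays in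
      \<open>P\<close>, where the functional vanishes.\<close>
    have "lin_ext (\<lambda>a. h i (x * a * y)) f = 0" for i x y
      using h(3)[OF P_right[OF P_left[OF f(1)]], of "bvec x" "bvec y" i] lin_ext_fmul_bvec[OF f(2)]
      by (simp add: bvec_free_sp)
    then show False
      using not_just_infinite_by_specialization[OF unc ac cg f(2) \<theta>(1,2) \<theta>_f h(1,2)] ji by blast
  qed
qed

end

theorem theorem1p5:
  fixes scale :: "'k::field \<Rightarrow> 'a::ring_1 \<Rightarrow> 'a"
  assumes "uncountable (UNIV :: 'k set)"
    and "alg_closed_field TYPE('k)"
    and "is_k_algebra scale"
    and "just_infinite scale"
    and "countably_generated scale"
  shows "just_infinite scale \<and>
         (\<forall>\<iota> :: 'k \<Rightarrow> 'K::field. field_ext \<iota> \<longrightarrow> base_change_just_infinite scale \<iota>)"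
proof (intro conjI allI impI)
  fix \<iota> :: "'k \<Rightarrow> 'K" assume "field_ext \<iota>"
  then interpret scalar_extension \<iota> scale
    using assms(3) by unfold_locales
  show "base_change_just_infinite scale \<iota>"
    using assms by (intro base_change_just_infinite)
qed (rule assms(4))

end
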